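(* Let $(M,\Sigma,\lambda)$ be the completion of a Liouville domain with Liouville vector field $\Lambda$, let $J$ be an SFT-like almost complex structure on $M$ with metric $g=d\lambda(\cdot,J\cdot)$, and let $H\in C^\infty(M,\mathbb{R})$ be a defining Hamiltonian for $(\Sigma,\lambda|_\Sigma)$ with $\Sigma=H^{-1}(0)$ and $H(r,x)=e^r-1$ near $\Sigma$, such that the constrained action functional $\mathfrak{a}^H$ is Morse-Bott. Suppose that $\iota_{\nabla H}\,d\lambda=\lambda$ on $M$ (equivalently $\nabla H=\Lambda$). Then for all critical points $x^-,x^+\in\operatorname{crit}(\mathfrak{a}^H)$ there is a constant $C=C(x^\pm,H)$, depending only on $x^-$, $x^+$ and $H$, such that for all $u\in\mathcal{M}(x^-,x^+)$ $$\max_{s\in\mathbb{R}}|\chi(u(s))|\le C(x^\pm,H).$$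
   Context: Liouville domain: a compact symplectic manifold $(W,\omega)$ with boundary and a vector field $\Lambda$, transverse to $\partial W$ and outward pointing, such that $\lambda:=\iota_\Lambda\omega$ satisfies $d\lambda=\omega$. Put $\Sigma=\partial W$. Its completion is $M=W\sqcup_\Sigma([0,\infty)\times\Sigma)$; for some $\varepsilon>0$ an open set $U_\varepsilon\supset M^+:=[0,\infty)\times\Sigma$ has coordinates $(r,x)\in(-\varepsilon,\infty)\times\Sigma$ (from the flow of $\Lambda$, with $\Sigma=\{r=0\}$ and $\{r<0\}\subset W\setminus\Sigma$) in which $\Lambda=\partial_r$, $\lambda=e^r\lambda|_\Sigma$, $\omega=d\lambda=e^r(d\lambda|_\Sigma+dr\wedge\lambda|_\Sigma)$. $R$ is the Reeb vector field of $(\Sigma,\lambda|_\Sigma)$, extended $r$-independently to $U_\varepsilon$; $\xi=\ker\lambda|_\Sigma$. A $d\lambda$-compatible almost complex structure $J$ (i.e. $g=\omega(\cdot,J\cdot)$ is a Riemannian metric) is SFT-like if on $U_\varepsilon$: $J\Lambda=R$, $J|_\xi$ is $d\lambda|_\xi$-compatible, and $J$ is independent of $r$. $X_H$ and $\nabla H$ are defined by $dH=\omega(\cdot,X_H)=g(\nabla H,\cdot)$. $H$ is a defining Hamiltonian for $(\Sigma,\lambda|_\Sigma)$ if $0$ is a regular value, $\Sigma=H^{-1}(0)$ and $X_H=R$ on $\Sigma$. $\mathbb{S}^1=\mathbb{R}/\mathbb{Z}$. On loops $\gamma:\mathbb{S}^1\to M$ (class $W^{1,p}$, $p>1$) set $\mathfrak{a}(\gamma)=-\int_{\mathbb{S}^1}\gamma^*\lambda$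 and $h(\gamma)=\int_0^1H(\gamma(t))\,dt$, with differentials $d\mathfrak{a}_\gamma(X)=\int_0^1\omega(\partial_t\gamma,X)\,dt$, $dh_\gamma(X)=\int_0^1dH(X)\,dt$. $\mathcal{H}=h^{-1}(0)$ is a codimension one Banach submanifold of the loop space with $T_\gamma\mathcal{H}=\ker dh_\gamma$; $\mathfrak{a}^H=\mathfrak{a}|_{\mathcal{H}}$; the constraint factor is $\chi(\gamma)=-\dfrac{d\mathfrak{a}_\gamma(\nabla H|_\gamma)}{dh_\gamma(\nabla H|_\gamma)}$ for $\gamma\in\mathcal{H}$ (the denominator is positive). The $L^2$-gradient is $\nabla\mathfrak{a}^H(\gamma)=J(\gamma)\partial_t\gamma+\chi(\gamma)\nabla H|_\gamma$. Critical points of $\mathfrak{a}^H$ are smooth loops lying in $\Sigma$. Morse-Bott is meant in the usual sense ($\operatorname{crit}(\mathfrak{a}^H)$ is a properly embedded submanifold whose tangent spaces are the kernels of the Hessian). $\mathcal{M}(x^-,x^+)$ is the set of $u\in C^\infty(\mathbb{R},\mathcal{H})$ (viewed as smooth maps $\mathbb{R}\times\mathbb{S}^1\to M$) with $\partial_su=-\nabla\mathfrak{a}^H(u)$ and $u(s,\cdot)\to x^\pm$ in $C^1$ as $s\to\pm\infty$. *)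

theory Defs
  imports "HOL-Analysis.Analysis"
begin

section \<open>Smooth maps between Euclidean spaces\<close>

primrec Ck_on :: "nat \<Rightarrow> 'p::real_normed_vector set \<Rightarrow> ('p \<Rightarrow> 'v::real_normed_vector) \<Rightarrow> bool" where
  "Ck_on 0 S f \<longleftrightarrow> continuous_on S f"
| "Ck_on (Suc k) S f \<longleftrightarrow> (\<forall>x\<in>S. f differentiable (at x)) \<and>
     (\<forall>v. Ck_on k S (\<lambda>x. frechet_derivative f (at x) v))"

text \<open>Only used for open sets \<open>S\<close> in finite-dimensional spaces.\<close>

definition smooth_on :: "'p::real_normed_vector set \<Rightarrow> ('p \<Rightarrow> 'v::real_normed_vector) \<Rightarrow> bool" where
  "smooth_on S f \<longleftrightarrow> (\<forall>k. Ck_on k S f)"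


section \<open>Manifolds and tangent vectors\<close>

text \<open>The manifold is the whole type \<open>'a\<close>, modelled on \<open>'e\<close>. A chart is a pair of its domain and its
  coordinate map.\<close>

type_synonym ('a, 'e) chart = "'a set \<times> ('a \<Rightarrow> 'e)"

definition smooth_atlas ::
    "('a::{t2_space, second_countable_topology}, 'e::euclidean_space) chart set \<Rightarrow> bool" where
  "smooth_atlas A \<longleftrightarrow>
     (\<Union>(U, \<phi>)\<in>A. U) = UNIV \<and>
     (\<forall>(U, \<phi>)\<in>A. open U \<and> open (\<phi> ` U) \<and> homeomorphism U (\<phi> ` U) \<phi> (inv_into U \<phi>)) \<and>
     (\<forall>(U, \<phi>)\<in>A. \<forall>(V, \<psi>)\<in>A. smooth_on (\<phi> ` (U \<inter> V)) (\<psi> \<circ> inv_into U \<phi>))"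

definition compatible_charts ::
    "('a::{t2_space, second_countable_topology}, 'e::euclidean_space) chart set \<Rightarrow> ('a, 'e) chart set" where
  "compatible_charts A = {c. smooth_atlas (insert c A)}"

text \<open>The tangent space at \<open>p\<close> is \<open>'e\<close>, through the coordinates of one chart around \<open>p\<close> which is
  selected once and for all. Hence a vector field is a map \<open>'a \<Rightarrow> 'e\<close>, a 1-form is a map
  \<open>'a \<Rightarrow> 'e \<Rightarrow> real\<close>, and so on; their smoothness is tested in all charts of the atlas, after the
  change of coordinates.\<close>

definition chart_at :: "('a, 'e) chart set \<Rightarrow> 'a \<Rightarrow> ('a, 'e) chart" where
  "chart_at A p = (SOME c. c \<in> A \<and> p \<in> fst c)"

definition coord_at :: "('a, 'e) chart set \<Rightarrow> 'a \<Rightarrow> 'a \<Rightarrow> 'e" where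
  "coord_at A p = snd (chart_at A p)"

definition param_at :: "('a, 'e) chart set \<Rightarrow> 'a \<Rightarrow> 'e \<Rightarrow> 'a" where
  "param_at A p = inv_into (fst (chart_at A p)) (snd (chart_at A p))"

text \<open>Differentials: \<open>mdiff\<close> of a vector-valued map on the manifold, \<open>pdiff\<close> of a map from a vector
  space to the manifold, \<open>tdiff\<close> of a map from the manifold to itself.\<close>

definition mdiff :: "('a, 'e::euclidean_space) chart set \<Rightarrow> ('a \<Rightarrow> 'v::real_normed_vector) \<Rightarrow> 'a \<Rightarrow> 'e \<Rightarrow> 'v" where
  "mdiff A f p = frechet_derivative (f \<circ> param_at A p) (at (coord_at A p p))"

definition pdiff :: "('a, 'e::euclidean_space) chart set \<Rightarrow> ('p::real_normed_vector \<Rightarrow> 'a) \<Rightarrow> 'p \<Rightarrow> 'p \<Rightarrow> 'e" where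
  "pdiff A F y = frechet_derivative (coord_at A (F y) \<circ> F) (at y)"

definition tdiff :: "('a, 'e::euclidean_space) chart set \<Rightarrow> ('a \<Rightarrow> 'a) \<Rightarrow> 'a \<Rightarrow> 'e \<Rightarrow> 'e" where
  "tdiff A f p = frechet_derivative (coord_at A (f p) \<circ> f \<circ> param_at A p) (at (coord_at A p p))"

definition velocity :: "('a, 'e::euclidean_space) chart set \<Rightarrow> (real \<Rightarrow> 'a) \<Rightarrow> real \<Rightarrow> 'e" where
  "velocity A c t = vector_derivative (coord_at A (c t) \<circ> c) (at t)"

definition has_velocity ::
    "('a::topological_space, 'e::euclidean_space) chart set \<Rightarrow> (real \<Rightarrow> 'a) \<Rightarrow> real \<Rightarrow> 'e \<Rightarrow> bool" where
  "has_velocity A c t v \<longleftrightarrow>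
     isCont c t \<and> ((coord_at A (c t) \<circ> c) has_vector_derivative v) (at t)"

definition smooth_fun_on ::
    "('a, 'e::euclidean_space) chart set \<Rightarrow> 'a set \<Rightarrow> ('a \<Rightarrow> 'v::real_normed_vector) \<Rightarrow> bool" where
  "smooth_fun_on A Q f \<longleftrightarrow> (\<forall>(U, \<phi>)\<in>A. smooth_on (\<phi> ` (U \<inter> Q)) (f \<circ> inv_into U \<phi>))"

definition smooth_plot_on ::
    "('a::topological_space, 'e::euclidean_space) chart set \<Rightarrow> 'p::real_normed_vector set \<Rightarrow> ('p \<Rightarrow> 'a) \<Rightarrow> bool" where
  "smooth_plot_on A S F \<longleftrightarrow>
     continuous_on S F \<and> (\<forall>(U, \<phi>)\<in>A. smooth_on {y \<in> S. F y \<in> U} (\<phi> \<circ> F))"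

definition smooth_map_on ::
    "('a::topological_space, 'e::euclidean_space) chart set \<Rightarrow> 'a set \<Rightarrow> ('a \<Rightarrow> 'a) \<Rightarrow> bool" where
  "smooth_map_on A Q f \<longleftrightarrow> (\<forall>(U, \<phi>)\<in>A. smooth_plot_on A (\<phi> ` (U \<inter> Q)) (f \<circ> inv_into U \<phi>))"

definition smooth_vector_field :: "('a, 'e::euclidean_space) chart set \<Rightarrow> ('a \<Rightarrow> 'e) \<Rightarrow> bool" where
  "smooth_vector_field A X \<longleftrightarrow>
     (\<forall>(U, \<phi>)\<in>A. smooth_on (\<phi> ` U) (\<lambda>y. let q = inv_into U \<phi> y in mdiff A \<phi> q (X q)))"

definition smooth_two_form ::
    "('a, 'e::euclidean_space) chart set \<Rightarrow> ('a \<Rightarrow> 'e \<Rightarrow> 'e \<Rightarrow> real) \<Rightarrow> bool" where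
  "smooth_two_form A \<omega> \<longleftrightarrow>
     (\<forall>p. bilinear (\<omega> p)) \<and> (\<forall>p v. \<omega> p v v = 0) \<and>
     (\<forall>(U, \<phi>)\<in>A. \<forall>v w. smooth_on (\<phi> ` U)
        (\<lambda>y. \<omega> (inv_into U \<phi> y) (pdiff A (inv_into U \<phi>) y v) (pdiff A (inv_into U \<phi>) y w)))"

definition smooth_endomorphism ::
    "('a, 'e::euclidean_space) chart set \<Rightarrow> ('a \<Rightarrow> 'e \<Rightarrow> 'e) \<Rightarrow> bool" where
  "smooth_endomorphism A J \<longleftrightarrow>
     (\<forall>p. linear (J p)) \<and>
     (\<forall>(U, \<phi>)\<in>A. \<forall>v. smooth_on (\<phi> ` U)
        (\<lambda>y. let q = inv_into U \<phi> y in mdiff A \<phi> q (J q (pdiff A (inv_into U \<phi>) y v))))"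

text \<open>Exterior derivatives of a 1-form and of a 2-form, by the coordinate formulas in the selected
  chart around \<open>p\<close>; for 1-forms \<open>d\<alpha>(X,Y) = X \<alpha>(Y) - Y \<alpha>(X) - \<alpha>([X,Y])\<close>.\<close>

definition ext_deriv1 ::
    "('a, 'e::euclidean_space) chart set \<Rightarrow> ('a \<Rightarrow> 'e \<Rightarrow> real) \<Rightarrow> 'a \<Rightarrow> 'e \<Rightarrow> 'e \<Rightarrow> real" where
  "ext_deriv1 A \<alpha> p v w =
     (let \<psi> = param_at A p; y0 = coord_at A p p;
          a = (\<lambda>x y. \<alpha> (\<psi> y) (pdiff A \<psi> y x))
      in frechet_derivative (a w) (at y0) v - frechet_derivative (a v) (at y0) w)"

definition ext_deriv2 ::
    "('a, 'e::euclidean_space) chart set \<Rightarrow> ('a \<Rightarrow> 'e \<Rightarrow> 'e \<Rightarrow> real) \<Rightarrow> 'a \<Rightarrow> 'e \<Rightarrow> 'e \<Rightarrow> 'e \<Rightarrow> real" where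
  "ext_deriv2 A \<omega> p u v w =
     (let \<psi> = param_at A p; y0 = coord_at A p p;
          a = (\<lambda>x x' y. \<omega> (\<psi> y) (pdiff A \<psi> y x) (pdiff A \<psi> y x'))
      in frechet_derivative (a v w) (at y0) u - frechet_derivative (a u w) (at y0) v
         + frechet_derivative (a u v) (at y0) w)"

text \<open>For a submanifold \<open>S\<close> this is the tangent space \<open>T\<^sub>pS\<close>.\<close>

definition tangent_to ::
    "('a::topological_space, 'e::euclidean_space) chart set \<Rightarrow> 'a set \<Rightarrow> 'a \<Rightarrow> 'e set" where
  "tangent_to A S p =
     {velocity A c 0 |c. smooth_plot_on A UNIV c \<and> range c \<subseteq> S \<and> c 0 = p}"


section \<open>Liouville domains and their completions\<close>

definition symplectic_form ::
    "('a, 'e::euclidean_space) chart set \<Rightarrow> ('a \<Rightarrow> 'e \<Rightarrow> 'e \<Rightarrow> real) \<Rightarrow> bool" where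
  "symplectic_form A \<omega> \<longleftrightarrow>
     smooth_two_form A \<omega> \<and> (\<forall>p u v w. ext_deriv2 A \<omega> p u v w = 0) \<and>
     (\<forall>p v. (\<forall>w. \<omega> p v w = 0) \<longrightarrow> v = 0)"

definition liouville_form :: "('a \<Rightarrow> 'e \<Rightarrow> 'e \<Rightarrow> real) \<Rightarrow> ('a \<Rightarrow> 'e) \<Rightarrow> 'a \<Rightarrow> 'e \<Rightarrow> real" where
  "liouville_form \<omega> \<Lambda> p v = \<omega> p (\<Lambda> p) v"

definition boundary_chart ::
    "('a::{t2_space, second_countable_topology}, 'e::euclidean_space) chart set \<Rightarrow> 'a set \<Rightarrow> 'a \<Rightarrow>
      ('a, 'e) chart \<Rightarrow> 'e \<Rightarrow> bool" where
  "boundary_chart A W p = (\<lambda>(U, \<phi>) b.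
     (U, \<phi>) \<in> compatible_charts A \<and> b \<in> Basis \<and> p \<in> U \<and>
     W \<inter> U = {q \<in> U. \<phi> q \<bullet> b \<le> \<phi> p \<bullet> b})"

text \<open>A Liouville domain, as a compact codimension-zero submanifold \<open>W\<close> with boundary \<open>frontier W\<close> of
  an exact symplectic manifold without boundary (such as its completion) to which \<open>\<omega>\<close> and \<open>\<Lambda>\<close>
  are extended. The last condition says that \<open>\<Lambda>\<close> is transverse to the boundary and points outward.\<close>

definition liouville_domain ::
    "('a::{t2_space, second_countable_topology}, 'e::euclidean_space) chart set \<Rightarrow> 'a set \<Rightarrow>
      ('a \<Rightarrow> 'e \<Rightarrow> 'e \<Rightarrow> real) \<Rightarrow> ('a \<Rightarrow> 'e) \<Rightarrow> bool" where
  "liouville_domain A W \<omega> \<Lambda> \<longleftrightarrow>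
     smooth_atlas A \<and> symplectic_form A \<omega> \<and> smooth_vector_field A \<Lambda> \<and>
     (\<forall>p. ext_deriv1 A (liouville_form \<omega> \<Lambda>) p = \<omega> p) \<and>
     compact W \<and>
     (\<forall>p\<in>frontier W. \<exists>c b. boundary_chart A W p c b) \<and>
     (\<forall>p\<in>frontier W. \<forall>c b. boundary_chart A W p c b \<longrightarrow> mdiff A (snd c) p (\<Lambda> p) \<bullet> b > 0)"

text \<open>The ambient manifold is the completion of \<open>W\<close>. The pair \<open>(r, \<pi>)\<close> is the coordinate
  diffeomorphism from the open set \<open>U\<close> onto \<open>(-\<epsilon>, \<infinity>) \<times> \<Sigma>\<close> (smooth, bijective, with injective
  differential), and \<open>F\<close> is its inverse, given by the flow of \<open>\<Lambda>\<close>.\<close>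

definition liouville_completion ::
    "('a::{t2_space, second_countable_topology}, 'e::euclidean_space) chart set \<Rightarrow> 'a set \<Rightarrow>
      ('a \<Rightarrow> 'e \<Rightarrow> 'e \<Rightarrow> real) \<Rightarrow> ('a \<Rightarrow> 'e) \<Rightarrow>
      real \<Rightarrow> 'a set \<Rightarrow> (real \<Rightarrow> 'a \<Rightarrow> 'a) \<Rightarrow> ('a \<Rightarrow> real) \<Rightarrow> ('a \<Rightarrow> 'a) \<Rightarrow> bool" where
  "liouville_completion A W \<omega> \<Lambda> \<epsilon> U F r \<pi> \<longleftrightarrow>
     (let \<Sigma> = frontier W; Mplus = {q \<in> U. r q \<ge> 0} in
     liouville_domain A W \<omega> \<Lambda> \<and>
     W \<union> Mplus = UNIV \<and> W \<inter> Mplus = \<Sigma> \<and>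
     \<epsilon> > 0 \<and> open U \<and> {q \<in> U. r q < 0} \<subseteq> W - \<Sigma> \<and>
     (\<forall>x\<in>\<Sigma>. F 0 x = x) \<and>
     (\<forall>x\<in>\<Sigma>. \<forall>s>-\<epsilon>. has_velocity A (\<lambda>s. F s x) s (\<Lambda> (F s x))) \<and>
     (\<forall>x\<in>\<Sigma>. \<forall>s>-\<epsilon>. F s x \<in> U \<and> r (F s x) = s \<and> \<pi> (F s x) = x) \<and>
     (\<forall>q\<in>U. r q > -\<epsilon> \<and> \<pi> q \<in> \<Sigma> \<and> F (r q) (\<pi> q) = q) \<and>
     smooth_fun_on A U r \<and> smooth_map_on A U \<pi> \<and>
     (\<forall>q\<in>U. \<forall>v. mdiff A r q v = 0 \<and> tdiff A \<pi> q v = 0 \<longrightarrow> v = 0) \<and>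
     (\<forall>q\<in>U. \<forall>v. liouville_form \<omega> \<Lambda> q v = exp (r q) * liouville_form \<omega> \<Lambda> (\<pi> q) (tdiff A \<pi> q v)))"

text \<open>The Reeb vector field of \<open>\<Sigma>\<close> with the contact form \<open>\<alpha>|\<^sub>\<Sigma>\<close> (where \<open>d\<alpha> = \<omega>\<close>), extended to \<open>U\<close>
  independently of \<open>r\<close>.\<close>

definition reeb_field ::
    "('a::topological_space, 'e::euclidean_space) chart set \<Rightarrow> 'a set \<Rightarrow>
      ('a \<Rightarrow> 'e \<Rightarrow> 'e \<Rightarrow> real) \<Rightarrow> ('a \<Rightarrow> 'e \<Rightarrow> real) \<Rightarrow> 'a set \<Rightarrow> ('a \<Rightarrow> real) \<Rightarrow> ('a \<Rightarrow> 'a) \<Rightarrow> ('a \<Rightarrow> 'e) \<Rightarrow> bool" where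
  "reeb_field A \<Sigma> \<omega> \<alpha> U r \<pi> R \<longleftrightarrow>
     (\<forall>x\<in>\<Sigma>. R x \<in> tangent_to A \<Sigma> x \<and> \<alpha> x (R x) = 1 \<and> (\<forall>v\<in>tangent_to A \<Sigma> x. \<omega> x (R x) v = 0)) \<and>
     (\<forall>q\<in>U. mdiff A r q (R q) = 0 \<and> tdiff A \<pi> q (R q) = R (\<pi> q))"

definition metric_of :: "('a \<Rightarrow> 'e \<Rightarrow> 'e \<Rightarrow> real) \<Rightarrow> ('a \<Rightarrow> 'e \<Rightarrow> 'e) \<Rightarrow> 'a \<Rightarrow> 'e \<Rightarrow> 'e \<Rightarrow> real" where
  "metric_of \<omega> J p v w = \<omega> p v (J p w)"

definition compatible_acs ::
    "('a, 'e::euclidean_space) chart set \<Rightarrow> ('a \<Rightarrow> 'e \<Rightarrow> 'e \<Rightarrow> real) \<Rightarrow> ('a \<Rightarrow> 'e \<Rightarrow> 'e) \<Rightarrow> bool" where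
  "compatible_acs A \<omega> J \<longleftrightarrow>
     smooth_endomorphism A J \<and> (\<forall>p v. J p (J p v) = - v) \<and>
     (\<forall>p v w. metric_of \<omega> J p v w = metric_of \<omega> J p w v) \<and>
     (\<forall>p v. v \<noteq> 0 \<longrightarrow> metric_of \<omega> J p v v > 0)"

text \<open>The contact distribution \<open>ker \<alpha>|\<^sub>\<Sigma>\<close>, extended to \<open>U\<close> independently of \<open>r\<close>.\<close>

definition contact_plane ::
    "('a, 'e::euclidean_space) chart set \<Rightarrow> ('a \<Rightarrow> 'e \<Rightarrow> real) \<Rightarrow> ('a \<Rightarrow> real) \<Rightarrow> 'a \<Rightarrow> 'e set" where
  "contact_plane A \<alpha> r q = {v. mdiff A r q v = 0 \<and> \<alpha> q v = 0}"

text \<open>Independence of \<open>r\<close> is expressed by the identification of \<open>T\<^sub>qM\<close> with \<open>\<real> \<oplus> T\<^sub>x\<Sigma>\<close>, \<open>x = \<pi> q\<close>, through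
  \<open>(dr, d\<pi>)\<close>.\<close>

definition sft_like ::
    "('a, 'e::euclidean_space) chart set \<Rightarrow> ('a \<Rightarrow> 'e \<Rightarrow> 'e \<Rightarrow> real) \<Rightarrow> ('a \<Rightarrow> 'e) \<Rightarrow>
      'a set \<Rightarrow> ('a \<Rightarrow> real) \<Rightarrow> ('a \<Rightarrow> 'a) \<Rightarrow> ('a \<Rightarrow> 'e) \<Rightarrow> ('a \<Rightarrow> 'e \<Rightarrow> 'e) \<Rightarrow> bool" where
  "sft_like A \<omega> \<Lambda> U r \<pi> R J \<longleftrightarrow>
     compatible_acs A \<omega> J \<and>
     (\<forall>q\<in>U. J q (\<Lambda> q) = R q) \<and>
     (\<forall>q\<in>U. let \<xi> = contact_plane A (liouville_form \<omega> \<Lambda>) r q in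
        (\<forall>v\<in>\<xi>. J q v \<in> \<xi>) \<and>
        (\<forall>v\<in>\<xi>. \<forall>w\<in>\<xi>. \<omega> q v (J q w) = \<omega> q w (J q v)) \<and>
        (\<forall>v\<in>\<xi>. v \<noteq> 0 \<longrightarrow> \<omega> q v (J q v) > 0)) \<and>
     (\<forall>q\<in>U. \<forall>q'\<in>U. \<pi> q = \<pi> q' \<longrightarrow> (\<forall>v v'.
        mdiff A r q v = mdiff A r q' v' \<and> tdiff A \<pi> q v = tdiff A \<pi> q' v' \<longrightarrow>
        mdiff A r q (J q v) = mdiff A r q' (J q' v') \<and>
        tdiff A \<pi> q (J q v) = tdiff A \<pi> q' (J q' v')))"


section \<open>Hamiltonians\<close>

definition hamiltonian_vf ::
    "('a, 'e::euclidean_space) chart set \<Rightarrow> ('a \<Rightarrow> 'e \<Rightarrow> 'e \<Rightarrow> real) \<Rightarrow> ('a \<Rightarrow> real) \<Rightarrow> 'a \<Rightarrow> 'e" where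
  "hamiltonian_vf A \<omega> H p = (THE X. \<forall>v. mdiff A H p v = \<omega> p v X)"

definition gradient ::
    "('a, 'e::euclidean_space) chart set \<Rightarrow> ('a \<Rightarrow> 'e \<Rightarrow> 'e \<Rightarrow> real) \<Rightarrow> ('a \<Rightarrow> real) \<Rightarrow> 'a \<Rightarrow> 'e" where
  "gradient A g H p = (THE X. \<forall>v. mdiff A H p v = g p X v)"

definition defining_hamiltonian ::
    "('a, 'e::euclidean_space) chart set \<Rightarrow> 'a set \<Rightarrow> ('a \<Rightarrow> 'e \<Rightarrow> 'e \<Rightarrow> real) \<Rightarrow> ('a \<Rightarrow> 'e) \<Rightarrow> ('a \<Rightarrow> real) \<Rightarrow> bool" where
  "defining_hamiltonian A \<Sigma> \<omega> R H \<longleftrightarrow>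
     smooth_fun_on A UNIV H \<and>
     (\<forall>p. H p = 0 \<longrightarrow> (\<exists>v. mdiff A H p v \<noteq> 0)) \<and>
     \<Sigma> = {p. H p = 0} \<and>
     (\<forall>p\<in>\<Sigma>. hamiltonian_vf A \<omega> H p = R p)"


section \<open>The loop space of class $W^{1,p}$\<close>

definition w1p_on :: "real \<Rightarrow> real \<Rightarrow> real \<Rightarrow> (real \<Rightarrow> 'v::euclidean_space) \<Rightarrow> bool" where
  "w1p_on p a c f \<longleftrightarrow> (\<exists>g. g absolutely_integrable_on {a..c} \<and>
     (\<lambda>t. norm (g t) powr p) integrable_on {a..c} \<and>
     (\<forall>t\<in>{a..c}. f t = f a + integral {a..t} g))"

definition w1p_norm :: "real \<Rightarrow> real \<Rightarrow> real \<Rightarrow> (real \<Rightarrow> 'v::euclidean_space) \<Rightarrow> real" where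
  "w1p_norm p a c f =
     integral {a..c} (\<lambda>t. norm (f t) powr p) powr (1 / p) +
     integral {a..c} (\<lambda>t. norm (vector_derivative f (at t)) powr p) powr (1 / p)"

text \<open>Loops are 1-periodic maps on the real line.\<close>

definition w1p_loops ::
    "('a::topological_space, 'e::euclidean_space) chart set \<Rightarrow> real \<Rightarrow> (real \<Rightarrow> 'a) set" where
  "w1p_loops A p = {\<gamma>. (\<forall>t. \<gamma> (t + 1) = \<gamma> t) \<and> continuous_on UNIV \<gamma> \<and>
     (\<forall>(U, \<phi>)\<in>A. \<forall>a c. a < c \<and> \<gamma> ` {a..c} \<subseteq> U \<longrightarrow> w1p_on p a c (\<phi> \<circ> \<gamma>))}"

definition w1p_converges ::
    "('a::topological_space, 'e::euclidean_space) chart set \<Rightarrow> real \<Rightarrow> (nat \<Rightarrow> real \<Rightarrow> 'a) \<Rightarrow> (real \<Rightarrow> 'a) \<Rightarrow> bool" where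
  "w1p_converges A p \<sigma> \<gamma> \<longleftrightarrow>
     (\<forall>(U, \<phi>)\<in>A. \<forall>a c. a < c \<and> \<gamma> ` {a..c} \<subseteq> U \<longrightarrow>
        (\<forall>\<^sub>F n in sequentially. \<sigma> n ` {a..c} \<subseteq> U) \<and>
        (\<lambda>n. w1p_norm p a c (\<lambda>t. \<phi> (\<sigma> n t) - \<phi> (\<gamma> t))) \<longlonglongrightarrow> 0)"

text \<open>The loop space is metrizable, so its topology is determined by its convergent sequences.\<close>

definition w1p_topology ::
    "('a::topological_space, 'e::euclidean_space) chart set \<Rightarrow> real \<Rightarrow> (real \<Rightarrow> 'a) topology" where
  "w1p_topology A p = topology (\<lambda>Q. Q \<subseteq> w1p_loops A p \<and>
     (\<forall>\<gamma>\<in>Q. \<forall>\<sigma>. range \<sigma> \<subseteq> w1p_loops A p \<and> w1p_converges A p \<sigma> \<gamma> \<longrightarrow>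
        (\<forall>\<^sub>F n in sequentially. \<sigma> n \<in> Q)))"

lemma istopology_w1p:
  "istopology (\<lambda>Q. Q \<subseteq> w1p_loops A p \<and>
     (\<forall>\<gamma>\<in>Q. \<forall>\<sigma>. range \<sigma> \<subseteq> w1p_loops A p \<and> w1p_converges A p \<sigma> \<gamma> \<longrightarrow>
        (\<forall>\<^sub>F n in sequentially. \<sigma> n \<in> Q)))"
  unfolding istopology_def
proof (intro conjI allI impI, goal_cases)
  case (1 S T)
  then show ?case by auto
next
  case (2 S T)
  then show ?case by (auto simp: eventually_conj_iff)
next
  case (3 K)
  then show ?case by blast
next
  case (4 K)
  show ?case
  proof (intro ballI allI impI)
    fix \<gamma> \<sigma>
    assume "\<gamma> \<in> \<Union>K" and \<sigma>: "range \<sigma> \<subseteq> w1p_loops A p \<and> w1p_converges A p \<sigma> \<gamma>"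
    then obtain Q where Q: "Q \<in> K" "\<gamma> \<in> Q" by blast
    with 4 \<sigma> have "\<forall>\<^sub>F n in sequentially. \<sigma> n \<in> Q" by blast
    then show "\<forall>\<^sub>F n in sequentially. \<sigma> n \<in> \<Union>K"
      by (rule eventually_mono) (use Q in blast)
  qed
qed

lemma openin_w1p_topology:
  "openin (w1p_topology A p) Q \<longleftrightarrow> Q \<subseteq> w1p_loops A p \<and>
     (\<forall>\<gamma>\<in>Q. \<forall>\<sigma>. range \<sigma> \<subseteq> w1p_loops A p \<and> w1p_converges A p \<sigma> \<gamma> \<longrightarrow>
        (\<forall>\<^sub>F n in sequentially. \<sigma> n \<in> Q))"
  unfolding w1p_topology_def by (simp add: topology_inverse' [OF istopology_w1p])

lemma topspace_w1p_topology: "topspace (w1p_topology A p) = w1p_loops A p"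
proof
  show "topspace (w1p_topology A p) \<subseteq> w1p_loops A p"
    using openin_w1p_topology openin_topspace by blast
  have "openin (w1p_topology A p) (w1p_loops A p)"
    unfolding openin_w1p_topology by (auto intro!: always_eventually)
  then show "w1p_loops A p \<subseteq> topspace (w1p_topology A p)"
    by (rule openin_subset)
qed

text \<open>$C^\infty$ maps into the Banach space $W^{1,p}([a,c])$ from a relatively open subset \<open>S\<close> of a
  finite-dimensional subspace \<open>T\<close>; \<open>D [v\<^sub>1, \<dots>, v\<^sub>n]\<close> is the iterated directional derivative
  \<open>\<partial>\<^sub>v\<^sub>1 \<dots> \<partial>\<^sub>v\<^sub>n G\<close>, taken in the $W^{1,p}$-norm.\<close>

definition w1p_smooth ::
    "real \<Rightarrow> real \<Rightarrow> real \<Rightarrow> 'p::real_normed_vector set \<Rightarrow> 'p set \<Rightarrow> ('p \<Rightarrow> real \<Rightarrow> 'v::euclidean_space) \<Rightarrow> bool" where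
  "w1p_smooth p a c T S G \<longleftrightarrow> (\<exists>D. D [] = G \<and>
     (\<forall>vs\<in>lists T. \<forall>b\<in>S.
        w1p_on p a c (D vs b) \<and>
        ((\<lambda>b'. w1p_norm p a c (\<lambda>t. D vs b' t - D vs b t)) \<longlongrightarrow> 0) (at b within S) \<and>
        (\<forall>v\<in>T. ((\<lambda>h. w1p_norm p a c
           (\<lambda>t. (D vs (b + h *\<^sub>R v) t - D vs b t) /\<^sub>R h - D (v # vs) b t)) \<longlongrightarrow> 0) (at 0))))"

text \<open>Smooth finite-dimensional families of loops, i.e. smooth maps into the Banach manifold of
  $W^{1,p}$-loops.\<close>

definition smooth_loop_family ::
    "('a::topological_space, 'e::euclidean_space) chart set \<Rightarrow> real \<Rightarrow>
      'p::real_normed_vector set \<Rightarrow> 'p set \<Rightarrow> ('p \<Rightarrow> real \<Rightarrow> 'a) \<Rightarrow> bool" where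
  "smooth_loop_family A p T S \<Gamma> \<longleftrightarrow>
     subspace T \<and> openin (top_of_set T) S \<and> \<Gamma> ` S \<subseteq> w1p_loops A p \<and>
     (\<forall>b\<in>S. \<forall>(U, \<phi>)\<in>A. \<forall>a c. a < c \<and> \<Gamma> b ` {a..c} \<subseteq> U \<longrightarrow>
        (\<exists>V. open V \<and> b \<in> V \<and> (\<forall>b'\<in>S \<inter> V. \<Gamma> b' ` {a..c} \<subseteq> U) \<and>
           w1p_smooth p a c T (S \<inter> V) (\<lambda>b' t. \<phi> (\<Gamma> b' t))))"

text \<open>The tangent vector \<open>d\<Gamma>(b)v\<close>, a section along the loop \<open>\<Gamma> b\<close>.\<close>

definition family_deriv ::
    "('a, 'e::euclidean_space) chart set \<Rightarrow> ('p::real_normed_vector \<Rightarrow> real \<Rightarrow> 'a) \<Rightarrow> 'p \<Rightarrow> 'p \<Rightarrow> real \<Rightarrow> 'e" where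
  "family_deriv A \<Gamma> b v = (\<lambda>t. velocity A (\<lambda>h. \<Gamma> (b + h *\<^sub>R v) t) 0)"

definition w1p_sections ::
    "('a, 'e::euclidean_space) chart set \<Rightarrow> real \<Rightarrow> (real \<Rightarrow> 'a) \<Rightarrow> (real \<Rightarrow> 'e) set" where
  "w1p_sections A p \<gamma> = {X. (\<forall>t. X (t + 1) = X t) \<and>
     (\<forall>(U, \<phi>)\<in>A. \<forall>a c. a < c \<and> \<gamma> ` {a..c} \<subseteq> U \<longrightarrow>
        w1p_on p a c (\<lambda>t. mdiff A \<phi> (\<gamma> t) (X t)))}"

definition c1_converges ::
    "('a, 'e::euclidean_space) chart set \<Rightarrow> (real \<Rightarrow> real \<Rightarrow> 'a) \<Rightarrow> (real \<Rightarrow> 'a) \<Rightarrow> real filter \<Rightarrow> bool" where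
  "c1_converges A u x F \<longleftrightarrow>
     (\<forall>(U, \<phi>)\<in>A. \<forall>a c. a < c \<and> x ` {a..c} \<subseteq> U \<longrightarrow>
        (\<forall>\<^sub>F s in F. u s ` {a..c} \<subseteq> U) \<and>
        uniform_limit {a..c} (\<lambda>s. \<phi> \<circ> u s) (\<phi> \<circ> x) F \<and>
        uniform_limit {a..c} (\<lambda>s t. vector_derivative (\<phi> \<circ> u s) (at t))
          (\<lambda>t. vector_derivative (\<phi> \<circ> x) (at t)) F)"


section \<open>The constrained action functional\<close>

definition action :: "('a, 'e::euclidean_space) chart set \<Rightarrow> ('a \<Rightarrow> 'e \<Rightarrow> real) \<Rightarrow> (real \<Rightarrow> 'a) \<Rightarrow> real" where
  "action A \<alpha> \<gamma> = - integral {0..1} (\<lambda>t. \<alpha> (\<gamma> t) (velocity A \<gamma> t))"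

definition mean_value :: "('a \<Rightarrow> real) \<Rightarrow> (real \<Rightarrow> 'a) \<Rightarrow> real" where
  "mean_value H \<gamma> = integral {0..1} (\<lambda>t. H (\<gamma> t))"

definition d_action ::
    "('a, 'e::euclidean_space) chart set \<Rightarrow> ('a \<Rightarrow> 'e \<Rightarrow> 'e \<Rightarrow> real) \<Rightarrow> (real \<Rightarrow> 'a) \<Rightarrow> (real \<Rightarrow> 'e) \<Rightarrow> real" where
  "d_action A \<omega> \<gamma> X = integral {0..1} (\<lambda>t. \<omega> (\<gamma> t) (velocity A \<gamma> t) (X t))"

definition d_mean_value ::
    "('a, 'e::euclidean_space) chart set \<Rightarrow> ('a \<Rightarrow> real) \<Rightarrow> (real \<Rightarrow> 'a) \<Rightarrow> (real \<Rightarrow> 'e) \<Rightarrow> real" where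
  "d_mean_value A H \<gamma> X = integral {0..1} (\<lambda>t. mdiff A H (\<gamma> t) (X t))"

definition constraint_set ::
    "('a::topological_space, 'e::euclidean_space) chart set \<Rightarrow> real \<Rightarrow> ('a \<Rightarrow> real) \<Rightarrow> (real \<Rightarrow> 'a) set" where
  "constraint_set A p H = {\<gamma> \<in> w1p_loops A p. mean_value H \<gamma> = 0}"

definition constraint_tangent ::
    "('a, 'e::euclidean_space) chart set \<Rightarrow> real \<Rightarrow> ('a \<Rightarrow> real) \<Rightarrow> (real \<Rightarrow> 'a) \<Rightarrow> (real \<Rightarrow> 'e) set" where
  "constraint_tangent A p H \<gamma> = {X \<in> w1p_sections A p \<gamma>. d_mean_value A H \<gamma> X = 0}"

definition critical_loops ::
    "('a::topological_space, 'e::euclidean_space) chart set \<Rightarrow> real \<Rightarrow> ('a \<Rightarrow> 'e \<Rightarrow> 'e \<Rightarrow> real) \<Rightarrow>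
      ('a \<Rightarrow> real) \<Rightarrow> (real \<Rightarrow> 'a) set" where
  "critical_loops A p \<omega> H =
     {\<gamma> \<in> constraint_set A p H. \<forall>X\<in>constraint_tangent A p H \<gamma>. d_action A \<omega> \<gamma> X = 0}"

text \<open>The Hessian of the constrained action at a critical loop \<open>x\<close>: the mixed second derivative along
  any two-parameter family in the constraint set with the given first derivatives at \<open>x\<close>.\<close>

definition hessian ::
    "('a::topological_space, 'e::euclidean_space) chart set \<Rightarrow> real \<Rightarrow> ('a \<Rightarrow> 'e \<Rightarrow> real) \<Rightarrow> ('a \<Rightarrow> real) \<Rightarrow>
      (real \<Rightarrow> 'a) \<Rightarrow> (real \<Rightarrow> 'e) \<Rightarrow> (real \<Rightarrow> 'e) \<Rightarrow> real" where
  "hessian A p \<alpha> H x X Y = (THE c. \<forall>S \<Gamma>.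
     (0, 0) \<in> S \<and> smooth_loop_family A p UNIV S \<Gamma> \<and> \<Gamma> ` S \<subseteq> constraint_set A p H \<and>
     \<Gamma> (0, 0) = x \<and> family_deriv A \<Gamma> (0, 0) (1, 0) = X \<and> family_deriv A \<Gamma> (0, 0) (0, 1) = Y \<longrightarrow>
     deriv (\<lambda>\<sigma>::real. deriv (\<lambda>\<tau>::real. action A \<alpha> (\<Gamma> (\<sigma>, \<tau>))) 0) 0 = c)"

definition hessian_kernel ::
    "('a::topological_space, 'e::euclidean_space) chart set \<Rightarrow> real \<Rightarrow> ('a \<Rightarrow> 'e \<Rightarrow> real) \<Rightarrow> ('a \<Rightarrow> real) \<Rightarrow>
      (real \<Rightarrow> 'a) \<Rightarrow> (real \<Rightarrow> 'e) set" where
  "hessian_kernel A p \<alpha> H x =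
     {X \<in> constraint_tangent A p H x. \<forall>Y\<in>constraint_tangent A p H x. hessian A p \<alpha> H x X Y = 0}"

text \<open>The critical set is a properly embedded (i.e. closed) submanifold with tangent spaces the kernels
  of the Hessian. \<open>\<Gamma>\<close> is the inverse of a chart around \<open>x\<close>, an immersion which is a homeomorphism onto
  an open subset of the critical set. Its dimension may vary; parameters in subspaces of \<open>'e\<close> suffice:
  kernel elements solve a linear first order equation along \<open>x\<close> and are determined by
  their value in \<open>T\<^bsub>x(0)\<^esub>M\<close>.\<close>

definition morse_bott ::
    "('a::topological_space, 'e::euclidean_space) chart set \<Rightarrow> real \<Rightarrow> ('a \<Rightarrow> 'e \<Rightarrow> 'e \<Rightarrow> real) \<Rightarrow>
      ('a \<Rightarrow> 'e \<Rightarrow> real) \<Rightarrow> ('a \<Rightarrow> real) \<Rightarrow> bool" where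
  "morse_bott A p \<omega> \<alpha> H \<longleftrightarrow>
     (let L = w1p_topology A p; C = critical_loops A p \<omega> H in
      closedin (subtopology L (constraint_set A p H)) C \<and>
      (\<forall>x\<in>C. \<exists>(T::'e set) S \<Gamma>.
         smooth_loop_family A p T S \<Gamma> \<and> 0 \<in> S \<and> \<Gamma> 0 = x \<and>
         openin (subtopology L C) (\<Gamma> ` S) \<and>
         homeomorphic_map (top_of_set S) (subtopology L (\<Gamma> ` S)) \<Gamma> \<and>
         (\<forall>b\<in>S. \<forall>v\<in>T. family_deriv A \<Gamma> b v = (\<lambda>t. 0) \<longrightarrow> v = 0) \<and>
         {family_deriv A \<Gamma> 0 v |v. v \<in> T} = hessian_kernel A p \<alpha> H x))"

definition constraint_factor ::
    "('a, 'e::euclidean_space) chart set \<Rightarrow> ('a \<Rightarrow> 'e \<Rightarrow> 'e \<Rightarrow> real) \<Rightarrow> ('a \<Rightarrow> 'e \<Rightarrow> 'e) \<Rightarrow> ('a \<Rightarrow> real) \<Rightarrow>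
      (real \<Rightarrow> 'a) \<Rightarrow> real" where
  "constraint_factor A \<omega> J H \<gamma> =
     - d_action A \<omega> \<gamma> (gradient A (metric_of \<omega> J) H \<circ> \<gamma>) /
       d_mean_value A H \<gamma> (gradient A (metric_of \<omega> J) H \<circ> \<gamma>)"

definition action_gradient ::
    "('a, 'e::euclidean_space) chart set \<Rightarrow> ('a \<Rightarrow> 'e \<Rightarrow> 'e \<Rightarrow> real) \<Rightarrow> ('a \<Rightarrow> 'e \<Rightarrow> 'e) \<Rightarrow> ('a \<Rightarrow> real) \<Rightarrow>
      (real \<Rightarrow> 'a) \<Rightarrow> real \<Rightarrow> 'e" where
  "action_gradient A \<omega> J H \<gamma> t =
     J (\<gamma> t) (velocity A \<gamma> t) +
     constraint_factor A \<omega> J H \<gamma> *\<^sub>R gradient A (metric_of \<omega> J) H (\<gamma> t)"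

definition flow_lines ::
    "('a::topological_space, 'e::euclidean_space) chart set \<Rightarrow> real \<Rightarrow> ('a \<Rightarrow> 'e \<Rightarrow> 'e \<Rightarrow> real) \<Rightarrow>
      ('a \<Rightarrow> 'e \<Rightarrow> 'e) \<Rightarrow> ('a \<Rightarrow> real) \<Rightarrow> (real \<Rightarrow> 'a) \<Rightarrow> (real \<Rightarrow> 'a) \<Rightarrow> (real \<Rightarrow> real \<Rightarrow> 'a) set" where
  "flow_lines A p \<omega> J H xm xp = {u.
     smooth_plot_on A UNIV (\<lambda>(s, t). u s t) \<and>
     (\<forall>s. u s \<in> constraint_set A p H) \<and>
     (\<forall>s t. velocity A (\<lambda>s'. u s' t) s = - action_gradient A \<omega> J H (u s) t) \<and>
     c1_converges A u xm at_bot \<and> c1_converges A u xp at_top}"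

end

theory Submission
  imports Defs
begin

text \<open>
  Since \<open>\<nabla>H = \<Lambda>\<close>, the numerator of the constraint factor is the action itself, so that
  \<open>\<chi>(u) = - \<a>(u) / \<integral> dH(\<Lambda>)(u)\<close>. The action is nonincreasing along a flow line and is bounded near
  its ends in terms of \<open>x\<^sup>\<plusminus>\<close>, hence bounded throughout. For the denominator, \<open>H + \<delta> \<le> dH(\<Lambda>)\<close> on \<open>M\<close>
  for some \<open>\<delta> > 0\<close>, and \<open>H\<close> has mean value \<open>0\<close>. Indeed on the cylindrical end \<open>dH(\<Lambda>) = \<lambda>(R) = e\<^sup>r\<close>,
  so \<open>H = e\<^sup>r - 1\<close> by integration along \<open>\<Lambda>\<close>; on the compact rest \<open>dH(\<Lambda>) \<ge> 0\<close>, and \<open>H < 0\<close> because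
  \<open>\<lambda> = - dH \<circ> J\<close> makes \<open>H\<close> strictly plurisubharmonic, which excludes local maxima. Neither \<open>\<delta>\<close> nor
  the bounds on the action depend on \<open>J\<close>.
\<close>


section \<open>Derivatives in Euclidean space\<close>

text \<open>The constant has to be chosen before \<open>J\<close>, while the pieces of the bound are
  obtained with the help of \<open>J\<close>: the gap \<delta> through plurisubharmonicity, the
  bounds on the action through regularity of the Liouville form and through an actual flow line. The
  way out is that the resulting statements mention only \<open>A\<close>, \<omega>, \<Lambda>,
  \<open>H\<close> and the two loops. If some admissible \<open>J\<close> has a flow line at all,
  one such pair serves as a witness for them; otherwise there is nothing to bound. Tangent vectors
  are written in a chart that is selected pointwise and jumps from point to point, so a map such as
  \<open>\<lambda>z. pdiff A u z d\<close> need not be continuous. Regularity arguments therefore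
  pass to one chart kept fixed near the point in question, and only quantities that do not depend on
  the chart are compared. The identity \<lambda> = - dH o J does double duty: its coordinate form
  exhibits the Liouville form as C^1, and differentiating that form gives the plurisubharmonicity of
  \<open>H\<close>.\<close>

lemma Ck_on_has_derivative:
  assumes "Ck_on (Suc k) S f" "x \<in> S"
  shows "(f has_derivative frechet_derivative f (at x)) (at x)"
  using assms by (simp add: frechet_derivative_works[symmetric])

lemma Ck_on_1_continuous: "Ck_on (Suc 0) S f \<Longrightarrow> continuous_on S f"
  by (auto intro!: continuous_at_imp_continuous_on differentiable_imp_continuous_within)

lemma Ck_on_1I:
  assumes "\<And>x. x \<in> S \<Longrightarrow> (f has_derivative f' x) (at x)" "\<And>v. continuous_on S (\<lambda>x. f' x v)"
  shows "Ck_on (Suc 0) S f"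
proof -
  have "frechet_derivative f (at x) = f' x" if "x \<in> S" for x
    using frechet_derivative_at[OF assms(1)[OF that]] by simp
  moreover from this have "continuous_on S (\<lambda>x. frechet_derivative f (at x) v)" for v
    using assms(2)[of v] by (simp cong: continuous_on_cong)
  ultimately show ?thesis using assms(1) by (auto simp: differentiable_def)
qed

text \<open>The derivatives in \<open>Ck_on\<close> are taken in the full space, not within
  \<open>S\<close>; since \<open>S\<close> is open, the values on \<open>S\<close> determine
  them.\<close>

lemma Ck_on_cong:
  assumes "open S" "\<And>x. x \<in> S \<Longrightarrow> f x = g x" "Ck_on k S f"
  shows "Ck_on k S g"
  using assms(2,3)
proof (induction k arbitrary: f g)
  case 0
  then show ?case by (simp cong: continuous_on_cong)
next
  case (Suc k)
  have g: "(g has_derivative frechet_derivative f (at x)) (at x)" if "x \<in> S" for x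
    by (rule has_derivative_transform_within_open[OF Ck_on_has_derivative[OF Suc.prems(2) that] assms(1) that])
      (rule Suc.prems(1))
  then have "frechet_derivative f (at x) v = frechet_derivative g (at x) v" if "x \<in> S" for x v
    using frechet_derivative_at that by metis
  then have "Ck_on k S (\<lambda>x. frechet_derivative g (at x) v)" for v
    by (rule Suc.IH) (use Suc.prems(2) in auto)
  with g show ?case by (auto simp: differentiable_def)
qed

lemma Ck_on_subset: "Ck_on k S f \<Longrightarrow> T \<subseteq> S \<Longrightarrow> Ck_on k T f"
  by (induction k arbitrary: f) (auto intro: continuous_on_subset)

lemma Ck_on_1_local:
  assumes "\<And>x. x \<in> S \<Longrightarrow> \<exists>T. open T \<and> x \<in> T \<and> Ck_on (Suc 0) T f"
  shows "Ck_on (Suc 0) S f"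
proof -
  have "f differentiable at x \<and> continuous (at x) (\<lambda>x. frechet_derivative f (at x) v)"
    if "x \<in> S" for x v
    using assms[OF that] by (auto simp: continuous_on_eq_continuous_at)
  then show ?thesis by (auto intro!: continuous_at_imp_continuous_on)
qed

lemma Ck_on_1_continuous_derivative:
  "Ck_on (Suc 0) S f \<Longrightarrow> continuous_on S (\<lambda>x. frechet_derivative f (at x) v)"
  by simp

lemma Ck_on_1_sum:
  assumes "\<And>i. i \<in> I \<Longrightarrow> Ck_on (Suc 0) S (f i)"
  shows "Ck_on (Suc 0) S (\<lambda>x. \<Sum>i\<in>I. f i x)"
proof (rule Ck_on_1I)
  show "((\<lambda>x. \<Sum>i\<in>I. f i x) has_derivative (\<lambda>v. \<Sum>i\<in>I. frechet_derivative (f i) (at x) v)) (at x)"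
    if "x \<in> S" for x
    by (intro has_derivative_sum Ck_on_has_derivative[OF assms that])
  show "continuous_on S (\<lambda>x. \<Sum>i\<in>I. frechet_derivative (f i) (at x) v)" for v
    by (intro continuous_on_sum Ck_on_1_continuous_derivative assms)
qed

lemma Ck_on_1_minus:
  assumes "Ck_on (Suc 0) S f"
  shows "Ck_on (Suc 0) S (\<lambda>x. - f x)"
proof (rule Ck_on_1I)
  show "((\<lambda>x. - f x) has_derivative (\<lambda>v. - frechet_derivative f (at x) v)) (at x)" if "x \<in> S" for x
    by (intro has_derivative_minus Ck_on_has_derivative[OF assms that])
  show "continuous_on S (\<lambda>x. - frechet_derivative f (at x) v)" for v
    by (intro continuous_on_minus Ck_on_1_continuous_derivative assms)
qed

lemma Ck_on_1_mult:
  fixes f g :: "'p::real_normed_vector \<Rightarrow> real"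
  assumes f: "Ck_on (Suc 0) S f" and g: "Ck_on (Suc 0) S g"
  shows "Ck_on (Suc 0) S (\<lambda>x. f x * g x)"
proof (rule Ck_on_1I)
  show "((\<lambda>x. f x * g x) has_derivative
      (\<lambda>v. f x * frechet_derivative g (at x) v + frechet_derivative f (at x) v * g x)) (at x)"
    if "x \<in> S" for x
    by (intro has_derivative_mult Ck_on_has_derivative[OF f that] Ck_on_has_derivative[OF g that])
  show "continuous_on S (\<lambda>x. f x * frechet_derivative g (at x) v + frechet_derivative f (at x) v * g x)" for v
    by (intro continuous_on_add continuous_on_mult Ck_on_1_continuous[OF f] Ck_on_1_continuous[OF g]
      Ck_on_1_continuous_derivative[OF f] Ck_on_1_continuous_derivative[OF g])
qed

lemma linear_eq_sum_Basis:
  fixes f :: "'e::euclidean_space \<Rightarrow> 'v::real_vector"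
  assumes "linear f"
  shows "f x = (\<Sum>i\<in>Basis. (x \<bullet> i) *\<^sub>R f i)"
  using linear_sum[OF assms, of "\<lambda>i. (x \<bullet> i) *\<^sub>R i" Basis] 
  by (simp add: linear_scale[OF assms] euclidean_representation)

lemma linear_Ck_on_derivative: "Ck_on (Suc k) S f \<Longrightarrow> x \<in> S \<Longrightarrow> linear (frechet_derivative f (at x))"
  using Ck_on_has_derivative has_derivative_linear by blast

text \<open>\<open>Ck_on\<close> controls the derivative only for a fixed direction. Expanding the
  moving direction \<open>w x\<close> in the basis reduces to that case.\<close>

lemma continuous_on_Ck_on_derivative:
  fixes f :: "'e::euclidean_space \<Rightarrow> 'v::real_normed_vector"
  assumes "Ck_on (Suc 0) S f" "continuous_on T g" "g ` T \<subseteq> S" "continuous_on T w"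
  shows "continuous_on T (\<lambda>x. frechet_derivative f (at (g x)) (w x))"
proof -
  have "continuous_on T (\<lambda>x. \<Sum>i\<in>Basis. (w x \<bullet> i) *\<^sub>R frechet_derivative f (at (g x)) i)"
    using assms by (intro continuous_intros continuous_on_compose2[OF _ assms(2,3)]) auto
  moreover have "frechet_derivative f (at (g x)) (w x) =
      (\<Sum>i\<in>Basis. (w x \<bullet> i) *\<^sub>R frechet_derivative f (at (g x)) i)" if "x \<in> T" for x
    using linear_eq_sum_Basis linear_Ck_on_derivative[OF assms(1), of "g x"] assms(3) that by blast
  ultimately show ?thesis by (simp cong: continuous_on_cong)
qed

lemma Ck_on_1_compose:
  fixes g :: "'e::euclidean_space \<Rightarrow> 'v::real_normed_vector"
  assumes f: "Ck_on (Suc 0) S f" and g: "Ck_on (Suc 0) T g" and sub: "f ` S \<subseteq> T"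
  shows "Ck_on (Suc 0) S (\<lambda>x. g (f x))"
proof (rule Ck_on_1I)
  show "((\<lambda>x. g (f x)) has_derivative
      (\<lambda>v. frechet_derivative g (at (f x)) (frechet_derivative f (at x) v))) (at x)" if "x \<in> S" for x
    using has_derivative_compose[OF Ck_on_has_derivative[OF f that] Ck_on_has_derivative[OF g]] sub that
    by blast
  show "continuous_on S (\<lambda>x. frechet_derivative g (at (f x)) (frechet_derivative f (at x) v))" for v
    using f by (intro continuous_on_Ck_on_derivative[OF g Ck_on_1_continuous[OF f] sub]) auto
qed

section \<open>Symmetry of second derivatives\<close>

lemma second_difference_mvt:
  fixes f :: "'p::real_normed_vector \<Rightarrow> real"
  assumes f: "Ck_on (Suc (Suc 0)) S f" and ball: "ball z e \<subseteq> S"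
    and h: "h > 0" "h * (norm c + norm d) < e"
  shows "\<exists>w\<in>ball z e. f (z + h *\<^sub>R c + h *\<^sub>R d) - f (z + h *\<^sub>R c) - f (z + h *\<^sub>R d) + f z =
    h\<^sup>2 * frechet_derivative (\<lambda>x. frechet_derivative f (at x) c) (at w) d"
proof -
  define P where "P x = frechet_derivative f (at x) c" for x
  have P: "Ck_on (Suc 0) S P" using f by (simp add: P_def[abs_def])
  have f1: "Ck_on (Suc 0) S f" using f by (auto intro!: continuous_at_imp_continuous_on differentiable_imp_continuous_within)
  have inS: "z + s *\<^sub>R c + t *\<^sub>R d \<in> ball z e" if "0 \<le> s" "s \<le> h" "0 \<le> t" "t \<le> h" for s t
  proof -
    have "norm (s *\<^sub>R c + t *\<^sub>R d) \<le> s * norm c + t * norm d"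
      using norm_triangle_ineq[of "s *\<^sub>R c" "t *\<^sub>R d"] that by simp
    also have "\<dots> \<le> h * norm c + h * norm d"
      using that by (intro add_mono mult_right_mono) auto
    finally have "norm (s *\<^sub>R c + t *\<^sub>R d) < e" using h by (simp add: algebra_simps)
    then show ?thesis
      by (metis add.assoc add_diff_cancel_left' dist_commute dist_norm mem_ball)
  qed
  \<comment> \<open>\<open>\<phi>\<close> is the increment of \<open>f\<close> in direction
    \<open>d\<close>, as a function of the position along \<open>c\<close>. The mean value theorem
    is applied to it, and then to \<open>P\<close> along \<open>d\<close>.\<close>
  define \<phi> where "\<phi> s = f (z + s *\<^sub>R c + h *\<^sub>R d) - f (z + s *\<^sub>R c)" for s
  have line: "((\<lambda>s. f (z + s *\<^sub>R c + t *\<^sub>R d)) has_real_derivative P (z + s *\<^sub>R c + t *\<^sub>R d)) (at s)"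
    if "0 \<le> s" "s \<le> h" "0 \<le> t" "t \<le> h" for s t
  proof -
    have "((\<lambda>s. z + s *\<^sub>R c + t *\<^sub>R d) has_derivative (\<lambda>s. s *\<^sub>R c)) (at s)"
      by (auto intro!: derivative_eq_intros)
    from has_derivative_compose[OF this Ck_on_has_derivative[OF f1]]
    have "((\<lambda>s. f (z + s *\<^sub>R c + t *\<^sub>R d)) has_derivative
      (\<lambda>r. frechet_derivative f (at (z + s *\<^sub>R c + t *\<^sub>R d)) (r *\<^sub>R c))) (at s)"
      using inS[OF that] ball by blast
    moreover have "linear (frechet_derivative f (at (z + s *\<^sub>R c + t *\<^sub>R d)))"
      using linear_Ck_on_derivative[OF f1] inS[OF that] ball by blast
    ultimately show ?thesis
      by (simp add: has_field_derivative_def P_def linear_scale mult_commute_abs)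
  qed
  have "\<exists>\<xi>. 0 < \<xi> \<and> \<xi> < h \<and> \<phi> h - \<phi> 0 = (h - 0) * (P (z + \<xi> *\<^sub>R c + h *\<^sub>R d) - P (z + \<xi> *\<^sub>R c))"
    unfolding \<phi>_def by (rule MVT2) (use h line[of _ h] line[of _ 0] in \<open>auto intro!: derivative_intros\<close>)
  then obtain \<xi> where \<xi>: "0 < \<xi>" "\<xi> < h"
    "\<phi> h - \<phi> 0 = h * (P (z + \<xi> *\<^sub>R c + h *\<^sub>R d) - P (z + \<xi> *\<^sub>R c))" by auto
  have line': "((\<lambda>t. P (z + \<xi> *\<^sub>R c + t *\<^sub>R d)) has_real_derivative
      frechet_derivative P (at (z + \<xi> *\<^sub>R c + t *\<^sub>R d)) d) (at t)" if "0 \<le> t" "t \<le> h" for t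
  proof -
    have "((\<lambda>t. z + \<xi> *\<^sub>R c + t *\<^sub>R d) has_derivative (\<lambda>t. t *\<^sub>R d)) (at t)"
      by (auto intro!: derivative_eq_intros)
    from has_derivative_compose[OF this Ck_on_has_derivative[OF P]]
    have "((\<lambda>t. P (z + \<xi> *\<^sub>R c + t *\<^sub>R d)) has_derivative
      (\<lambda>r. frechet_derivative P (at (z + \<xi> *\<^sub>R c + t *\<^sub>R d)) (r *\<^sub>R d))) (at t)"
      using inS[of \<xi> t] that \<xi> ball by force
    moreover have "linear (frechet_derivative P (at (z + \<xi> *\<^sub>R c + t *\<^sub>R d)))"
      using linear_Ck_on_derivative[OF P] inS[of \<xi> t] that \<xi> ball by force
    ultimately show ?thesis
      by (simp add: has_field_derivative_def linear_scale mult_commute_abs)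
  qed
  have "\<exists>\<eta>. 0 < \<eta> \<and> \<eta> < h \<and> P (z + \<xi> *\<^sub>R c + h *\<^sub>R d) - P (z + \<xi> *\<^sub>R c + 0 *\<^sub>R d) =
      (h - 0) * frechet_derivative P (at (z + \<xi> *\<^sub>R c + \<eta> *\<^sub>R d)) d"
    by (rule MVT2) (use h line' in auto)
  then obtain \<eta> where \<eta>: "0 < \<eta>" "\<eta> < h" "P (z + \<xi> *\<^sub>R c + h *\<^sub>R d) - P (z + \<xi> *\<^sub>R c) =
      h * frechet_derivative P (at (z + \<xi> *\<^sub>R c + \<eta> *\<^sub>R d)) d" by auto
  show ?thesis
    using inS[of \<xi> \<eta>] \<xi> \<eta> unfolding P_def[abs_def, symmetric]
    by (intro bexI[of _ "z + \<xi> *\<^sub>R c + \<eta> *\<^sub>R d"]) (auto simp: \<phi>_def power2_eq_square)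
qed

text \<open>The second difference over a parallelogram is symmetric in its two sides. In either
  order it equals \<open>h\<^sup>2\<close> times a mixed derivative at some nearby point, so the two
  mixed derivatives share values at points arbitrarily close to \<open>z\<close>, and continuity at
  \<open>z\<close> forces them to agree there.\<close>

lemma mixed_derivatives_commute_real:
  fixes f :: "'p::real_normed_vector \<Rightarrow> real"
  assumes f: "Ck_on (Suc (Suc 0)) S f" and S: "open S" "z \<in> S"
  shows "frechet_derivative (\<lambda>x. frechet_derivative f (at x) c) (at z) d =
    frechet_derivative (\<lambda>x. frechet_derivative f (at x) d) (at z) c"
proof (rule ccontr)
  define P where "P c d x = frechet_derivative (\<lambda>x. frechet_derivative f (at x) c) (at x) d" for c d x
  assume "\<not> ?thesis"
  then have "\<bar>P c d z - P d c z\<bar> / 2 > 0" (is "?k > 0") by (simp add: P_def)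
  have cont: "isCont (P c d) z" for c d
    using f S by (auto simp: P_def[abs_def] continuous_on_eq_continuous_at)
  obtain e1 where e1: "e1 > 0" "\<And>w. dist w z < e1 \<Longrightarrow> dist (P c d w) (P c d z) < ?k"
    using cont[of c d] \<open>?k > 0\<close> unfolding continuous_at_eps_delta by blast
  obtain e2 where e2: "e2 > 0" "\<And>w. dist w z < e2 \<Longrightarrow> dist (P d c w) (P d c z) < ?k"
    using cont[of d c] \<open>?k > 0\<close> unfolding continuous_at_eps_delta by blast
  obtain e3 where e3: "e3 > 0" "ball z e3 \<subseteq> S" using S openE by blast
  define e where "e = min e1 (min e2 e3)"
  have e: "e > 0" "ball z e \<subseteq> S" using e1 e2 e3 by (auto simp: e_def)
  \<comment> \<open>The summand 1 keeps the denominator positive when \<open>c\<close> and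
    \<open>d\<close> both vanish.\<close>
  define h where "h = e / (norm c + norm d + 1)"
  have pos: "norm c + norm d + 1 > 0" by (intro add_nonneg_pos add_nonneg_nonneg) auto
  then have h: "h > 0" using e by (simp add: h_def)
  have "h * (norm c + norm d) < h * (norm c + norm d + 1)" using h by simp
  also have "\<dots> = e" using pos by (simp add: h_def)
  finally have he: "h * (norm c + norm d) < e" .
  obtain w where w: "w \<in> ball z e"
    "f (z + h *\<^sub>R c + h *\<^sub>R d) - f (z + h *\<^sub>R c) - f (z + h *\<^sub>R d) + f z = h\<^sup>2 * P c d w"
    using second_difference_mvt[OF f e(2) h he] by (auto simp: P_def)
  obtain w' where w': "w' \<in> ball z e"
    "f (z + h *\<^sub>R d + h *\<^sub>R c) - f (z + h *\<^sub>R d) - f (z + h *\<^sub>R c) + f z = h\<^sup>2 * P d c w'"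
    using second_difference_mvt[OF f e(2) h, of d c] he by (auto simp: P_def add.commute)
  have comm: "z + h *\<^sub>R d + h *\<^sub>R c = z + h *\<^sub>R c + h *\<^sub>R d" by (simp add: ac_simps)
  have "h\<^sup>2 * P c d w = h\<^sup>2 * P d c w'" using w(2) w'(2) unfolding comm by linarith
  with h have "P c d w = P d c w'" by simp
  moreover have "dist w z < e1" "dist w' z < e2"
    using w(1) w'(1) by (auto simp: e_def dist_commute)
  ultimately show False
    using e1(2)[of w] e2(2)[of w'] unfolding dist_real_def by argo
qed

lemma smooth_on_Ck_on: "smooth_on S f \<Longrightarrow> Ck_on k S f"
  by (simp add: smooth_on_def)

lemma smooth_on_frechet_derivative:
  "smooth_on S f \<Longrightarrow> smooth_on S (\<lambda>x. frechet_derivative f (at x) v)"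
  unfolding smooth_on_def
proof
  fix k
  assume "\<forall>k. Ck_on k S f"
  then have "Ck_on (Suc k) S f" by blast
  then show "Ck_on k S (\<lambda>x. frechet_derivative f (at x) v)" by simp
qed

lemma differentiable_inner_const:
  "f differentiable at x \<Longrightarrow> (\<lambda>x. f x \<bullet> b) differentiable at x"
  unfolding differentiable_def by (metis has_derivative_inner_left)

lemma frechet_derivative_inner_const:
  assumes "f differentiable at x"
  shows "frechet_derivative (\<lambda>x. f x \<bullet> b) (at x) v = frechet_derivative f (at x) v \<bullet> b"
proof -
  have "(\<lambda>v. frechet_derivative f (at x) v \<bullet> b) = frechet_derivative (\<lambda>x. f x \<bullet> b) (at x)"
    using assms frechet_derivative_works
    by (intro frechet_derivative_at has_derivative_inner_left) blast
  then show ?thesis by (simp add: fun_eq_iff)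
qed

lemma Ck_on_inner_const:
  assumes "open S"
  shows "Ck_on k S f \<Longrightarrow> Ck_on k S (\<lambda>x. f x \<bullet> b)"
proof (induction k arbitrary: f)
  case 0
  then show ?case by (auto intro!: continuous_intros)
next
  case (Suc k)
  have "Ck_on k S (\<lambda>x. frechet_derivative (\<lambda>x. f x \<bullet> b) (at x) v)" for v
  proof (rule Ck_on_cong[OF assms])
    show "Ck_on k S (\<lambda>x. frechet_derivative f (at x) v \<bullet> b)"
      by (rule Suc.IH) (use Suc.prems in simp)
  qed (use Suc.prems in \<open>simp add: frechet_derivative_inner_const\<close>)
  then show ?case using Suc.prems by (simp add: differentiable_inner_const)
qed

lemma mixed_derivatives_commute:
  fixes f :: "'p::real_normed_vector \<Rightarrow> 'e::euclidean_space"
  assumes f: "Ck_on (Suc (Suc 0)) S f" and S: "open S" "z \<in> S"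
  shows "frechet_derivative (\<lambda>x. frechet_derivative f (at x) c) (at z) d =
    frechet_derivative (\<lambda>x. frechet_derivative f (at x) d) (at z) c"
proof (rule euclidean_eqI)
  fix b :: 'e
  have df: "f differentiable at x" if "x \<in> S" for x using f that by simp
  have ddf: "(\<lambda>x. frechet_derivative f (at x) c) differentiable at z" for c using f S by simp
  have *: "frechet_derivative (\<lambda>x. frechet_derivative f (at x) c) (at z) d \<bullet> b =
    frechet_derivative (\<lambda>x. frechet_derivative (\<lambda>x. f x \<bullet> b) (at x) c) (at z) d" for c d
  proof -
    have "frechet_derivative (\<lambda>x. frechet_derivative f (at x) c \<bullet> b) (at z) =
      frechet_derivative (\<lambda>x. frechet_derivative (\<lambda>x. f x \<bullet> b) (at x) c) (at z)"
      by (rule frechet_derivative_transform_within_open[OF differentiable_inner_const[OF ddf] S])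
        (simp add: frechet_derivative_inner_const[OF df])
    then show ?thesis using frechet_derivative_inner_const[OF ddf] by metis
  qed
  show "frechet_derivative (\<lambda>x. frechet_derivative f (at x) c) (at z) d \<bullet> b =
    frechet_derivative (\<lambda>x. frechet_derivative f (at x) d) (at z) c \<bullet> b"
    unfolding * by (rule mixed_derivatives_commute_real[OF Ck_on_inner_const[OF S(1) f] S])
qed


section \<open>Chain rules on manifolds\<close>

locale atlas_manifold =
  fixes A :: "('a::{t2_space, second_countable_topology}, 'e::euclidean_space) chart set"
  assumes atlas: "smooth_atlas A"
begin

lemma chart_at: "(fst (chart_at A q), coord_at A q) \<in> A" "q \<in> fst (chart_at A q)"
proof -
  obtain c where "c \<in> A" "q \<in> fst c"
    using atlas unfolding smooth_atlas_def by (metis (no_types, lifting) UNIV_I UN_E case_prod_beta)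
  then have "chart_at A q \<in> A \<and> q \<in> fst (chart_at A q)"
    unfolding chart_at_def by (intro someI[of "\<lambda>c. c \<in> A \<and> q \<in> fst c"]) auto
  then show "(fst (chart_at A q), coord_at A q) \<in> A" "q \<in> fst (chart_at A q)"
    by (simp_all add: coord_at_def)
qed

lemma param_at_eq: "param_at A q = inv_into (fst (chart_at A q)) (coord_at A q)"
  by (simp add: param_at_def coord_at_def)

lemma chart:
  assumes "(V, \<phi>) \<in> A"
  shows "open V" "open (\<phi> ` V)" "continuous_on V \<phi>" "continuous_on (\<phi> ` V) (inv_into V \<phi>)"
    and "\<And>q. q \<in> V \<Longrightarrow> inv_into V \<phi> (\<phi> q) = q"
proof -
  have *: "open V" "open (\<phi> ` V)" "homeomorphism V (\<phi> ` V) \<phi> (inv_into V \<phi>)"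
    using assms atlas by (auto simp: smooth_atlas_def)
  then show "open V" "open (\<phi> ` V)" "continuous_on V \<phi>" "continuous_on (\<phi> ` V) (inv_into V \<phi>)"
    and "\<And>q. q \<in> V \<Longrightarrow> inv_into V \<phi> (\<phi> q) = q"
    by (auto simp: homeomorphism_def)
qed

lemma open_chart_image:
  assumes "(V, \<phi>) \<in> A" "open Q"
  shows "open (\<phi> ` (V \<inter> Q))"
proof -
  have "\<phi> ` (V \<inter> Q) = \<phi> ` V \<inter> inv_into V \<phi> -` Q"
    using chart(5)[OF assms(1)] by (auto simp: image_iff)
  then show ?thesis
    using continuous_open_preimage[OF chart(4,2)[OF assms(1)] assms(2)] by simp
qed

lemma transition_differentiable:
  assumes "(V, \<phi>) \<in> A" "(V', \<phi>') \<in> A" "q \<in> V" "q \<in> V'"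
  shows "(\<phi>' \<circ> inv_into V \<phi>) differentiable at (\<phi> q)"
proof -
  have "smooth_on (\<phi> ` (V \<inter> V')) (\<phi>' \<circ> inv_into V \<phi>)"
    using assms atlas unfolding smooth_atlas_def by blast
  then have "Ck_on (Suc 0) (\<phi> ` (V \<inter> V')) (\<phi>' \<circ> inv_into V \<phi>)" by (rule smooth_on_Ck_on)
  then show ?thesis using assms by simp
qed

text \<open>\<open>mdiff\<close> is defined through the chart selected at \<open>q\<close>. The
  transition map from that chart to \<open>\<phi>\<close> is differentiable, so the chain rule
  carries over a derivative computed in \<open>\<phi>\<close>; the factor
  \<open>mdiff A \<phi> q\<close> is the change of coordinates.\<close>

lemma
  assumes V: "(V, \<phi>) \<in> A" "q \<in> V" and f: "(f \<circ> inv_into V \<phi>) differentiable at (\<phi> q)"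
  shows mdiff_has_derivative:
      "(f \<circ> param_at A q has_derivative mdiff A f q) (at (coord_at A q q))"
    and mdiff_eq: "mdiff A f q X = frechet_derivative (f \<circ> inv_into V \<phi>) (at (\<phi> q)) (mdiff A \<phi> q X)"
proof -
  let ?d = "fst (chart_at A q)" let ?c = "coord_at A q" let ?p = "param_at A q"
  note q = chart_at[of q]
  have p: "?p (?c q') = q'" if "q' \<in> ?d" for q'
    using chart(5)[OF q(1) that] by (simp add: param_at_eq)
  have tr: "(\<phi> \<circ> ?p has_derivative mdiff A \<phi> q) (at (?c q))"
    using transition_differentiable[OF q(1) V(1) q(2) V(2)]
    by (simp add: mdiff_def param_at_eq frechet_derivative_works)
  have "(f \<circ> inv_into V \<phi> has_derivative frechet_derivative (f \<circ> inv_into V \<phi>) (at (\<phi> q)))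
      (at ((\<phi> \<circ> ?p) (?c q)))"
    using f p q by (simp add: frechet_derivative_works)
  from diff_chain_at[OF tr this]
  have "(f \<circ> inv_into V \<phi> \<circ> (\<phi> \<circ> ?p) has_derivative
      frechet_derivative (f \<circ> inv_into V \<phi>) (at (\<phi> q)) \<circ> mdiff A \<phi> q) (at (?c q))" .
  then have *: "(f \<circ> ?p has_derivative
      frechet_derivative (f \<circ> inv_into V \<phi>) (at (\<phi> q)) \<circ> mdiff A \<phi> q) (at (?c q))"
    by (rule has_derivative_transform_within_open[OF _ open_chart_image[OF q(1) chart(1)[OF V(1)]]])
      (use V q p chart(5)[OF V(1)] in auto)
  from frechet_derivative_at[OF this]
  have eq: "mdiff A f q = frechet_derivative (f \<circ> inv_into V \<phi>) (at (\<phi> q)) \<circ> mdiff A \<phi> q"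
    by (simp add: mdiff_def)
  from eq * show "(f \<circ> ?p has_derivative mdiff A f q) (at (?c q))" by simp
  from eq show "mdiff A f q X = frechet_derivative (f \<circ> inv_into V \<phi>) (at (\<phi> q)) (mdiff A \<phi> q X)"
    by simp
qed

text \<open>The counterpart for maps into the manifold. Continuity of \<open>F\<close> keeps nearby
  values in \<open>V\<close>, where the two coordinate expressions differ by a transition
  map.\<close>

lemma
  assumes V: "(V, \<phi>) \<in> A" "F y \<in> V" and F: "isCont F y" "(\<phi> \<circ> F) differentiable at y"
  shows pdiff_has_derivative: "(coord_at A (F y) \<circ> F has_derivative pdiff A F y) (at y)"
    and pdiff_eq: "pdiff A F y w = pdiff A (inv_into V \<phi>) (\<phi> (F y)) (frechet_derivative (\<phi> \<circ> F) (at y) w)"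
proof -
  let ?c = "coord_at A (F y)" let ?\<psi> = "inv_into V \<phi>"
  note q = chart_at[of "F y"]
  have \<psi>: "?\<psi> (\<phi> q') = q'" if "q' \<in> V" for q'
    using chart(5)[OF V(1) that] .
  have tr: "(?c \<circ> ?\<psi> has_derivative pdiff A ?\<psi> (\<phi> (F y))) (at ((\<phi> \<circ> F) y))"
    using transition_differentiable[OF V(1) q(1) V(2) q(2)]
    by (simp add: pdiff_def \<psi> V frechet_derivative_works)
  obtain T where T: "open T" "y \<in> T" "\<And>x. x \<in> T \<Longrightarrow> F x \<in> V"
    using F(1)[unfolded continuous_at_open, rule_format, OF conjI, OF chart(1)[OF V(1)] V(2)] by blast
  from diff_chain_at[OF F(2)[unfolded frechet_derivative_works] tr]
  have *: "(?c \<circ> F has_derivative pdiff A ?\<psi> (\<phi> (F y)) \<circ> frechet_derivative (\<phi> \<circ> F) (at y)) (at y)"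
    by (rule has_derivative_transform_within_open[OF _ T(1,2)]) (simp add: T \<psi>)
  from frechet_derivative_at[OF this]
  have eq: "pdiff A F y = pdiff A ?\<psi> (\<phi> (F y)) \<circ> frechet_derivative (\<phi> \<circ> F) (at y)"
    by (simp add: pdiff_def)
  from eq * show "(?c \<circ> F has_derivative pdiff A F y) (at y)" by simp
  from eq show "pdiff A F y w = pdiff A ?\<psi> (\<phi> (F y)) (frechet_derivative (\<phi> \<circ> F) (at y) w)"
    by simp
qed

text \<open>The chain rule through the chart selected at \<open>F y\<close>. It is phrased for an
  arbitrary domain of \<open>F\<close>, so that it covers flow lines of \<Lambda> as well as
  two-parameter plots.\<close>

lemma compose_has_derivative:
  assumes f: "(f \<circ> param_at A (F y) has_derivative mdiff A f (F y)) (at (coord_at A (F y) (F y)))"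
    and F: "isCont F y" "(coord_at A (F y) \<circ> F has_derivative F') (at y)"
  shows "(f \<circ> F has_derivative (\<lambda>w. mdiff A f (F y) (F' w))) (at y)"
proof -
  let ?c = "coord_at A (F y)"
  note q = chart_at[of "F y"]
  obtain T where T: "open T" "y \<in> T" "\<And>x. x \<in> T \<Longrightarrow> F x \<in> fst (chart_at A (F y))"
    using F(1)[unfolded continuous_at_open, rule_format, OF conjI, OF chart(1)[OF q(1)] q(2)] by blast
  have "(f \<circ> param_at A (F y) has_derivative mdiff A f (F y)) (at ((?c \<circ> F) y))"
    using f by simp
  from diff_chain_at[OF F(2) this]
  have "(f \<circ> F has_derivative mdiff A f (F y) \<circ> F') (at y)"
    by (rule has_derivative_transform_within_open[OF _ T(1,2)])
      (simp add: T param_at_eq chart(5)[OF q(1)])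
  then show ?thesis by (simp add: o_def)
qed

lemma linear_pdiff_chart_inverse:
  assumes "(V, \<phi>) \<in> A" "q \<in> V"
  shows "linear (pdiff A (inv_into V \<phi>) (\<phi> q))"
proof -
  have "(coord_at A q \<circ> inv_into V \<phi>) differentiable at (\<phi> q)"
    by (rule transition_differentiable[OF assms(1) chart_at(1) assms(2) chart_at(2)])
  then show ?thesis
    by (simp add: pdiff_def chart(5)[OF assms] linear_frechet_derivative)
qed

text \<open>The chart selected at \<open>q\<close> is the one by which the tangent space at
  \<open>q\<close> is identified with the model space, so its own differential is the
  identity.\<close>

lemma mdiff_coord_at: "mdiff A (coord_at A q) q X = X"
  and pdiff_param_at: "pdiff A (param_at A q) (coord_at A q q) v = v"
proof -
  note q = chart_at[of q]
  have "((\<lambda>y. y) has_derivative (\<lambda>y. y)) (at (coord_at A q q))" by simp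
  then have "(coord_at A q \<circ> param_at A q has_derivative (\<lambda>y. y)) (at (coord_at A q q))"
    by (rule has_derivative_transform_within_open[OF _ chart(2)[OF q(1)]])
      (use q in \<open>auto simp: param_at_eq chart(5)[OF q(1)]\<close>)
  from frechet_derivative_at[OF this, symmetric]
  show "mdiff A (coord_at A q) q X = X" "pdiff A (param_at A q) (coord_at A q q) v = v"
    by (auto simp: mdiff_def pdiff_def param_at_eq chart(5)[OF q])
qed

lemma smooth_fun_on_UNIV: "smooth_fun_on A UNIV f \<Longrightarrow> (V, \<phi>) \<in> A \<Longrightarrow> smooth_on (\<phi> ` V) (f \<circ> inv_into V \<phi>)"
  by (auto simp: smooth_fun_on_def)

lemma smooth_fun_has_derivative:
  assumes "smooth_fun_on A UNIV f"
  shows "(f \<circ> param_at A q has_derivative mdiff A f q) (at (coord_at A q q))"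
proof -
  note q = chart_at[of q]
  have "Ck_on (Suc 0) (coord_at A q ` fst (chart_at A q)) (f \<circ> inv_into (fst (chart_at A q)) (coord_at A q))"
    by (rule smooth_on_Ck_on[OF smooth_fun_on_UNIV[OF assms q(1)]])
  then show ?thesis using q(2) by (intro mdiff_has_derivative[OF q]) simp
qed

lemma smooth_fun_mdiff:
  assumes "smooth_fun_on A UNIV f" "(V, \<phi>) \<in> A" "q \<in> V"
  shows "mdiff A f q X = frechet_derivative (f \<circ> inv_into V \<phi>) (at (\<phi> q)) (mdiff A \<phi> q X)"
proof -
  have "Ck_on (Suc 0) (\<phi> ` V) (f \<circ> inv_into V \<phi>)"
    by (rule smooth_on_Ck_on[OF smooth_fun_on_UNIV[OF assms(1,2)]])
  then show ?thesis using assms(3) by (intro mdiff_eq[OF assms(2,3)]) simp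
qed

lemma continuous_on_charts:
  assumes "\<And>V \<phi>. (V, \<phi>) \<in> A \<Longrightarrow> continuous_on (\<phi> ` V) (\<lambda>y. f (inv_into V \<phi> y))"
  shows "continuous_on UNIV f"
proof (rule continuous_at_imp_continuous_on, rule ballI)
  fix q0
  note q = chart_at[of q0]
  let ?V = "fst (chart_at A q0)" let ?\<phi> = "coord_at A q0"
  have "continuous_on ?V (\<lambda>q. f (inv_into ?V ?\<phi> (?\<phi> q)))"
    by (rule continuous_on_compose2[OF assms[OF q(1)] chart(3)[OF q(1)]]) auto
  then have "continuous_on ?V f"
    by (rule continuous_on_eq) (simp add: chart(5)[OF q(1)])
  then show "isCont f q0"
    using q chart(1)[OF q(1)] by (simp add: continuous_on_eq_continuous_at)
qed

lemma continuous_smooth_fun: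
  assumes "smooth_fun_on A UNIV f"
  shows "continuous_on UNIV f"
proof (rule continuous_on_charts)
  fix V \<phi> assume "(V, \<phi>) \<in> A"
  from smooth_on_Ck_on[OF smooth_fun_on_UNIV[OF assms this], of 0]
  show "continuous_on (\<phi> ` V) (\<lambda>y. f (inv_into V \<phi> y))" by (simp add: o_def)
qed

lemma linear_smooth_fun_mdiff: "smooth_fun_on A UNIV f \<Longrightarrow> linear (mdiff A f q)"
  using smooth_fun_has_derivative has_derivative_linear by blast

lemma smooth_plot_has_derivative:
  assumes "smooth_plot_on A UNIV F"
  shows "(coord_at A (F y) \<circ> F has_derivative pdiff A F y) (at y)" "isCont F y"
proof -
  note q = chart_at[of "F y"]
  show c: "isCont F y" using assms by (simp add: smooth_plot_on_def continuous_on_eq_continuous_at)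
  have "smooth_on {z \<in> UNIV. F z \<in> fst (chart_at A (F y))} (coord_at A (F y) \<circ> F)"
    using assms q(1) unfolding smooth_plot_on_def by blast
  then have "Ck_on (Suc 0) {z \<in> UNIV. F z \<in> fst (chart_at A (F y))} (coord_at A (F y) \<circ> F)"
    by (rule smooth_on_Ck_on)
  then show "(coord_at A (F y) \<circ> F has_derivative pdiff A F y) (at y)"
    using q by (intro pdiff_has_derivative[OF q c]) simp
qed

lemma has_velocity_compose:
  assumes "smooth_fun_on A UNIV f" "has_velocity A c t v"
  shows "((f \<circ> c) has_vector_derivative mdiff A f (c t) v) (at t)"
proof -
  have "(f \<circ> c has_derivative (\<lambda>w. mdiff A f (c t) (w *\<^sub>R v))) (at t)"
    using assms by (intro compose_has_derivative smooth_fun_has_derivative)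
      (auto simp: has_velocity_def has_vector_derivative_def)
  then show ?thesis
    using linear_smooth_fun_mdiff[OF assms(1)] by (simp add: has_vector_derivative_def linear_scale)
qed

end


section \<open>Pullback of one-forms\<close>

text \<open>This is the usual condition on coefficients:
  \<open>pdiff A (inv_into V \<phi>) y x\<close> is the coordinate field with constant components
  \<open>x\<close>. One derivative is what \<open>ext_deriv1\<close> consumes.\<close>

definition C1_one_form :: "('a, 'e::euclidean_space) chart set \<Rightarrow> ('a \<Rightarrow> 'e \<Rightarrow> real) \<Rightarrow> bool" where
  "C1_one_form A \<alpha> \<longleftrightarrow> (\<forall>q. linear (\<alpha> q)) \<and>
     (\<forall>(V, \<phi>)\<in>A. \<forall>x. Ck_on (Suc 0) (\<phi> ` V)
        (\<lambda>y. \<alpha> (inv_into V \<phi> y) (pdiff A (inv_into V \<phi>) y x)))"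

context atlas_manifold
begin

lemma one_form_coordinates:
  assumes "C1_one_form A \<alpha>" "(V, \<phi>) \<in> A" "q \<in> V"
  shows "\<alpha> q (pdiff A (inv_into V \<phi>) (\<phi> q) x) =
    (\<Sum>i\<in>Basis. (x \<bullet> i) * \<alpha> q (pdiff A (inv_into V \<phi>) (\<phi> q) i))"
proof -
  have "linear (\<alpha> q \<circ> pdiff A (inv_into V \<phi>) (\<phi> q))"
    using assms by (intro linear_compose linear_pdiff_chart_inverse) (auto simp: C1_one_form_def)
  from linear_eq_sum_Basis[OF this, of x] show ?thesis by simp
qed

text \<open>Pullback commutes with the exterior derivative, tested on the constant fields
  \<open>c\<close> and \<open>d\<close>, whose bracket vanishes. In coordinates the pullback is a
  sum of products of first derivatives of \<open>u\<close> with coefficients of \<alpha>; after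
  antisymmetrization the second derivatives of \<open>u\<close> cancel, and d\<alpha>
  remains.\<close>

lemma
  assumes \<alpha>: "C1_one_form A \<alpha>" and u: "smooth_plot_on A UNIV u"
  shows Ck_on_1_pullback: "Ck_on (Suc 0) UNIV (\<lambda>z. \<alpha> (u z) (pdiff A u z d))"
    and ext_deriv1_pullback:
      "frechet_derivative (\<lambda>z. \<alpha> (u z) (pdiff A u z d)) (at z) c -
       frechet_derivative (\<lambda>z. \<alpha> (u z) (pdiff A u z c)) (at z) d =
       ext_deriv1 A \<alpha> (u z) (pdiff A u z c) (pdiff A u z d)"
proof -
  let ?V = "\<lambda>z. fst (chart_at A (u z))"
  define N where "N z = {x. u x \<in> ?V z}" for z
  define y where "y z = coord_at A (u z) \<circ> u" for z
  define \<psi> where "\<psi> z = inv_into (?V z) (coord_at A (u z))" for z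
  define a where "a z v x = \<alpha> (\<psi> z x) (pdiff A (\<psi> z) x v)" for z v x
  note ch = chart_at[of "u z" for z]
  have N: "open (N z)" "z \<in> N z" for z
    using u chart(1)[OF ch(1)] ch(2)
    by (auto simp: N_def smooth_plot_on_def vimage_def[symmetric] open_vimage)
  have y: "smooth_on (N z) (y z)" for z
    using u ch(1) unfolding smooth_plot_on_def N_def y_def by fastforce
  have y_in: "y z ` N z \<subseteq> coord_at A (u z) ` ?V z" for z
    by (auto simp: N_def y_def)
  have y1: "Ck_on (Suc 0) (N z) (y z)" and y2: "Ck_on (Suc (Suc 0)) (N z) (y z)" for z
    by (rule smooth_on_Ck_on[OF y])+
  have Dy1: "Ck_on (Suc 0) (N z) (\<lambda>x. frechet_derivative (y z) (at x) d)" for z d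
    using y2[of z] by simp
  have a1: "Ck_on (Suc 0) (coord_at A (u z) ` ?V z) (a z v)" for z v
    using \<alpha> ch(1)[of z] unfolding C1_one_form_def a_def[abs_def] \<psi>_def by fastforce
  have ay: "Ck_on (Suc 0) (N z) (\<lambda>x. a z v (y z x))" for z v
    by (rule Ck_on_1_compose[OF y1 a1 y_in])
  \<comment> \<open>The left-hand side refers to the chart selected at \<open>u x\<close>, the
    right-hand side to the one selected at \<open>u z\<close>, for all \<open>x\<close> near
    \<open>z\<close>. Only the second form can be differentiated at \<open>z\<close>.\<close>
  have loc: "\<alpha> (u x) (pdiff A u x d) =
      (\<Sum>i\<in>Basis. (frechet_derivative (y z) (at x) d \<bullet> i) * a z i (y z x))" if "x \<in> N z" for x z d
  proof -
    have x: "u x \<in> ?V z" using that by (simp add: N_def)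
    have "coord_at A (u z) \<circ> u differentiable at x"
      using Ck_on_has_derivative[OF y1 that] unfolding y_def differentiable_def by blast
    from pdiff_eq[OF ch(1) x smooth_plot_has_derivative(2)[OF u] this]
    have "pdiff A u x d =
        pdiff A (\<psi> z) (coord_at A (u z) (u x)) (frechet_derivative (y z) (at x) d)"
      unfolding y_def \<psi>_def .
    moreover have "\<psi> z (coord_at A (u z) (u x)) = u x"
      using chart(5)[OF ch(1) x] by (simp add: \<psi>_def)
    ultimately show ?thesis
      using one_form_coordinates[OF \<alpha> ch(1) x, of "frechet_derivative (y z) (at x) d", folded \<psi>_def]
      by (simp add: a_def y_def)
  qed
  have C1: "Ck_on (Suc 0) (N z) (\<lambda>z. \<alpha> (u z) (pdiff A u z d))" for z d
  proof (rule Ck_on_cong[OF N(1)])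
    show "Ck_on (Suc 0) (N z)
        (\<lambda>x. \<Sum>i\<in>Basis. (frechet_derivative (y z) (at x) d \<bullet> i) * a z i (y z x))"
      by (intro Ck_on_1_sum Ck_on_1_mult Ck_on_inner_const N Dy1 ay)
  qed (simp add: loc)
  show "Ck_on (Suc 0) UNIV (\<lambda>z. \<alpha> (u z) (pdiff A u z d))"
    by (rule Ck_on_1_local) (use N C1 in blast)
  let ?y0 = "y z z"
  have D: "frechet_derivative (\<lambda>z. \<alpha> (u z) (pdiff A u z d)) (at z) c =
      (\<Sum>i\<in>Basis. (pdiff A u z d \<bullet> i) * frechet_derivative (a z i) (at ?y0) (pdiff A u z c) +
        (frechet_derivative (\<lambda>x. frechet_derivative (y z) (at x) d) (at z) c \<bullet> i) * a z i ?y0)" for c d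
  proof -
    have y0: "?y0 \<in> coord_at A (u z) ` ?V z" using y_in N(2) by blast
    have *: "pdiff A u z = frechet_derivative (y z) (at z)" by (simp add: pdiff_def y_def)
    have "((\<lambda>x. \<Sum>i\<in>Basis. (frechet_derivative (y z) (at x) d \<bullet> i) * a z i (y z x)) has_derivative
      (\<lambda>c. \<Sum>i\<in>Basis. (pdiff A u z d \<bullet> i) * frechet_derivative (a z i) (at ?y0) (pdiff A u z c) +
        (frechet_derivative (\<lambda>x. frechet_derivative (y z) (at x) d) (at z) c \<bullet> i) * a z i ?y0)) (at z)"
      unfolding *
      by (intro has_derivative_sum has_derivative_mult has_derivative_inner_left
        Ck_on_has_derivative[OF Dy1 N(2)]
        has_derivative_compose[OF Ck_on_has_derivative[OF y1 N(2)] Ck_on_has_derivative[OF a1 y0]])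
    then have "((\<lambda>z. \<alpha> (u z) (pdiff A u z d)) has_derivative
      (\<lambda>c. \<Sum>i\<in>Basis. (pdiff A u z d \<bullet> i) * frechet_derivative (a z i) (at ?y0) (pdiff A u z c) +
        (frechet_derivative (\<lambda>x. frechet_derivative (y z) (at x) d) (at z) c \<bullet> i) * a z i ?y0)) (at z)"
      by (rule has_derivative_transform_within_open[OF _ N]) (simp add: loc)
    then show ?thesis by (intro fun_cong[OF frechet_derivative_at[symmetric]])
  qed
  \<comment> \<open>\<open>ext_deriv1\<close> differentiates the form evaluated on a fixed vector,
    whereas \<open>D\<close> contains the derivatives of its coefficients along basis vectors;
    linearity matches the two.\<close>
  have ext: "frechet_derivative (a z w) (at ?y0) v =
      (\<Sum>i\<in>Basis. (w \<bullet> i) * frechet_derivative (a z i) (at ?y0) v)" for v w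
  proof -
    have y0: "?y0 \<in> coord_at A (u z) ` ?V z" using y_in N(2) by blast
    have "((\<lambda>x. \<Sum>i\<in>Basis. (w \<bullet> i) * a z i x) has_derivative
        (\<lambda>v. \<Sum>i\<in>Basis. (w \<bullet> i) * frechet_derivative (a z i) (at ?y0) v)) (at ?y0)"
      by (intro has_derivative_sum has_derivative_mult_right Ck_on_has_derivative[OF a1 y0])
    then have "(a z w has_derivative
        (\<lambda>v. \<Sum>i\<in>Basis. (w \<bullet> i) * frechet_derivative (a z i) (at ?y0) v)) (at ?y0)"
      by (rule has_derivative_transform_within_open[OF _ chart(2)[OF ch(1)] y0])
        (auto simp: a_def \<psi>_def chart(5)[OF ch(1)] one_form_coordinates[OF \<alpha> ch(1), symmetric])
    then show ?thesis by (intro fun_cong[OF frechet_derivative_at[symmetric]])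
  qed
  have "ext_deriv1 A \<alpha> (u z) (pdiff A u z c) (pdiff A u z d) =
      frechet_derivative (a z (pdiff A u z d)) (at ?y0) (pdiff A u z c) -
      frechet_derivative (a z (pdiff A u z c)) (at ?y0) (pdiff A u z d)"
    by (simp add: ext_deriv1_def Let_def a_def[abs_def] \<psi>_def y_def param_at_eq)
  then show "frechet_derivative (\<lambda>z. \<alpha> (u z) (pdiff A u z d)) (at z) c -
       frechet_derivative (\<lambda>z. \<alpha> (u z) (pdiff A u z c)) (at z) d =
       ext_deriv1 A \<alpha> (u z) (pdiff A u z c) (pdiff A u z d)"
    unfolding D mixed_derivatives_commute[OF y2 N, where c = d and d = c]
      ext[of "pdiff A u z d" "pdiff A u z c"] ext[of "pdiff A u z c" "pdiff A u z d"]
    by (simp add: sum.distrib)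
qed

end


section \<open>Liouville fields that are gradients\<close>

text \<open>Riesz representation: \<open>T\<close> collects the values of \<open>g X\<close> on the
  basis; it is injective by positivity, hence surjective by dimension. This gives a meaning to the
  \<open>THE\<close> in \<open>gradient\<close>.\<close>

lemma positive_bilinear_represents:
  fixes g :: "'e::euclidean_space \<Rightarrow> 'e \<Rightarrow> real"
  assumes g: "bilinear g" "\<And>v. v \<noteq> 0 \<Longrightarrow> g v v > 0" and f: "linear f"
  shows "\<exists>!X. \<forall>v. f v = g X v"
proof -
  have lin1: "linear (\<lambda>X. g X v)" and lin2: "linear (g v)" for v
    using g(1) by (auto simp: bilinear_def)
  define T where "T X = (\<Sum>i\<in>Basis. g X i *\<^sub>R i)" for X
  have T: "T X \<bullet> i = g X i" if "i \<in> Basis" for X i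
    using that by (simp add: T_def)
  have "linear T"
    by (simp add: linear_iff T_def linear_add[OF lin1] linear_scale[OF lin1] scaleR_add_left
      sum.distrib scaleR_sum_right)
  have eq: "X = Y" if "\<And>v. g X v = g Y v" for X Y
  proof (rule ccontr)
    assume "X \<noteq> Y"
    then have "g (X - Y) (X - Y) > 0" by (intro g(2)) simp
    then show False using linear_diff[OF lin1, of X Y "X - Y"] that by simp
  qed
  have "inj T"
  proof (rule injI)
    fix X Y assume "T X = T Y"
    then have "g X i = g Y i" if "i \<in> Basis" for i using T[OF that] by metis
    then have "g X = g Y" by (intro linear_eq_stdbasis lin2) auto
    then show "X = Y" by (intro eq) simp
  qed
  with \<open>linear T\<close> have "surj T" by (rule linear_injective_imp_surjective) simp
  then obtain X where "T X = (\<Sum>i\<in>Basis. f i *\<^sub>R i)" by (metis surjD)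
  then have "f i = g X i" if "i \<in> Basis" for i using T[OF that, of X] that by simp
  then have "f = g X" by (intro linear_eq_stdbasis lin2 f) auto
  with eq show ?thesis by metis
qed

text \<open>If the second derivative along \<open>v\<close> were positive, the first one, which
  vanishes at \<open>y\<close>, would be positive just beyond \<open>y\<close>, and by the mean
  value theorem \<open>h\<close> would exceed its maximum.\<close>

lemma second_derivative_nonpos_at_local_max:
  fixes h :: "'p::real_normed_vector \<Rightarrow> real"
  assumes h: "Ck_on (Suc (Suc 0)) S h" and S: "open S" "y \<in> S"
    and max: "\<And>x. x \<in> S \<Longrightarrow> h x \<le> h y"
  shows "frechet_derivative h (at y) v = 0"
    and "frechet_derivative (\<lambda>x. frechet_derivative h (at x) v) (at y) v \<le> 0"
proof -
  have dh: "(h has_derivative frechet_derivative h (at x)) (at x)" if "x \<in> S" for x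
    using Ck_on_has_derivative[OF h that] .
  have h1: "Ck_on (Suc 0) S (\<lambda>x. frechet_derivative h (at x) v)" using h by simp
  have D0: "frechet_derivative h (at y) = (\<lambda>v. 0)"
    by (rule differential_zero_maxmin[OF S(2,1) dh[OF S(2)]]) (use max in blast)
  then show "frechet_derivative h (at y) v = 0" by simp
  define P where "P x = frechet_derivative h (at x) v" for x
  obtain e where e: "e > 0" "ball y e \<subseteq> S" using S openE by blast
  define \<delta> where "\<delta> = e / (norm v + 1)"
  have "norm v + 1 > 0" by (intro add_nonneg_pos) auto
  then have \<delta>: "\<delta> > 0" "\<delta> * (norm v + 1) = e" using e by (auto simp: \<delta>_def)
  have inS: "y + t *\<^sub>R v \<in> S" if "0 \<le> t" "t < \<delta>" for t
  proof -
    have "t * norm v \<le> \<delta> * norm v" using that by (intro mult_right_mono) auto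
    also have "\<dots> < e" using \<delta> by (simp add: algebra_simps)
    finally have "y + t *\<^sub>R v \<in> ball y e" using that by (simp add: dist_norm)
    with e show ?thesis by blast
  qed
  have line: "((\<lambda>t. f (y + t *\<^sub>R v)) has_real_derivative f' v) (at t)"
    if "(f has_derivative f') (at (y + t *\<^sub>R v))" for f f' t
  proof -
    have "((\<lambda>t. y + t *\<^sub>R v) has_derivative (\<lambda>t. t *\<^sub>R v)) (at t)"
      by (auto intro!: derivative_eq_intros)
    from has_derivative_compose[OF this that]
    show ?thesis
      using linear_scale[OF has_derivative_linear[OF that]]
      by (simp add: has_field_derivative_def mult_commute_abs)
  qed
  show "frechet_derivative (\<lambda>x. frechet_derivative h (at x) v) (at y) v \<le> 0"
  proof (rule ccontr)
    assume "\<not> ?thesis"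
    then have pos: "frechet_derivative P (at y) v > 0" by (simp add: P_def[abs_def])
    have "((\<lambda>t. P (y + t *\<^sub>R v)) has_real_derivative frechet_derivative P (at y) v) (at 0)"
      using Ck_on_has_derivative[OF h1 S(2)] by (intro line) (simp add: P_def[abs_def])
    from DERIV_pos_inc_right[OF this pos] obtain d where
      d: "d > 0" "\<And>t. t > 0 \<Longrightarrow> t < d \<Longrightarrow> P (y + t *\<^sub>R v) > P y" by auto
    define t where "t = min (d / 2) (\<delta> / 2)"
    have t: "0 < t" "t < d" "t < \<delta>" using d \<delta> by (auto simp: t_def)
    have "\<exists>\<xi>. 0 < \<xi> \<and> \<xi> < t \<and> h (y + t *\<^sub>R v) - h (y + 0 *\<^sub>R v) = (t - 0) * P (y + \<xi> *\<^sub>R v)"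
    proof (rule MVT2[OF t(1)])
      show "((\<lambda>t. h (y + t *\<^sub>R v)) has_real_derivative P (y + x *\<^sub>R v)) (at x)"
        if "0 \<le> x" "x \<le> t" for x
        unfolding P_def by (rule line[OF dh[OF inS]]) (use that t in auto)
    qed
    then obtain \<xi> where "0 < \<xi>" "\<xi> < t" "h (y + t *\<^sub>R v) - h y = t * P (y + \<xi> *\<^sub>R v)" by auto
    moreover have "P (y + \<xi> *\<^sub>R v) > 0" using d(2)[of \<xi>] calculation t D0 by (simp add: P_def)
    ultimately have "h (y + t *\<^sub>R v) > h y" using t by (smt (verit) mult_pos_pos)
    with max[OF inS[of t]] t show False by auto
  qed
qed

text \<open>Collects the data belonging to one \<open>J\<close>, without the domain \<open>W\<close>
  and the loops, so that it can be interpreted both for a witness and for an arbitrary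
  \<open>J\<close>.\<close>

locale liouville_gradient = atlas_manifold A
  for A :: "('a::{t2_space, second_countable_topology}, 'e::euclidean_space) chart set" +
  fixes \<omega> :: "'a \<Rightarrow> 'e \<Rightarrow> 'e \<Rightarrow> real" and \<Lambda> :: "'a \<Rightarrow> 'e" and J :: "'a \<Rightarrow> 'e \<Rightarrow> 'e"
    and H :: "'a \<Rightarrow> real"
  assumes symplectic: "symplectic_form A \<omega>"
    and \<Lambda>_smooth: "smooth_vector_field A \<Lambda>"
    and ext_deriv_liouville: "\<And>q. ext_deriv1 A (liouville_form \<omega> \<Lambda>) q = \<omega> q"
    and acs: "compatible_acs A \<omega> J"
    and H_smooth: "smooth_fun_on A UNIV H"
    and gradient_liouville: "\<And>q v. \<omega> q (gradient A (metric_of \<omega> J) H q) v = liouville_form \<omega> \<Lambda> q v"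
begin

lemma linear_\<omega>: "linear (\<omega> q v)" "linear (\<lambda>v. \<omega> q v w)"
  using symplectic by (auto simp: symplectic_form_def smooth_two_form_def bilinear_def)

lemma \<omega>_self: "\<omega> q v v = 0"
  using symplectic by (auto simp: symplectic_form_def smooth_two_form_def)

lemma \<omega>_antisym: "\<omega> q v w = - \<omega> q w v"
proof -
  have "\<omega> q (v + w) (v + w) = \<omega> q v v + \<omega> q w v + (\<omega> q v w + \<omega> q w w)"
    by (simp only: linear_add[OF linear_\<omega>(1)] linear_add[OF linear_\<omega>(2)])
  then show ?thesis by (simp add: \<omega>_self)
qed

lemma J_J: "J q (J q v) = - v" and linear_J: "linear (J q)"
  and metric_sym: "\<omega> q v (J q w) = \<omega> q w (J q v)"
  and metric_pos: "v \<noteq> 0 \<Longrightarrow> \<omega> q v (J q v) > 0"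
  using acs by (auto simp: compatible_acs_def smooth_endomorphism_def metric_of_def)

lemma metric_nonneg: "\<omega> q v (J q v) \<ge> 0"
  using metric_pos[of v q] \<omega>_self[of q 0] linear_0[OF linear_J] by (cases "v = 0") auto

lemma gradient_eq: "gradient A (metric_of \<omega> J) H q = \<Lambda> q"
proof -
  have "\<omega> q (gradient A (metric_of \<omega> J) H q - \<Lambda> q) w = 0" for w
    using gradient_liouville[of q w] by (simp add: linear_diff[OF linear_\<omega>(2)] liouville_form_def)
  then have "gradient A (metric_of \<omega> J) H q - \<Lambda> q = 0"
    using symplectic unfolding symplectic_form_def by blast
  then show ?thesis by simp
qed

lemma mdiff_H: "mdiff A H q v = \<omega> q (\<Lambda> q) (J q v)"
proof -
  have "bilinear (metric_of \<omega> J q)"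
    using linear_compose[OF linear_J linear_\<omega>(1)] linear_\<omega>(2)
    by (auto simp: bilinear_def metric_of_def o_def)
  then have "\<exists>!X. \<forall>v. mdiff A H q v = metric_of \<omega> J q X v"
    by (rule positive_bilinear_represents[OF _ _ linear_smooth_fun_mdiff[OF H_smooth]])
      (simp add: metric_of_def metric_pos)
  from theI'[OF this]
  have "\<forall>v. mdiff A H q v = metric_of \<omega> J q (gradient A (metric_of \<omega> J) H q) v"
    unfolding gradient_def .
  then show ?thesis unfolding gradient_eq metric_of_def by blast
qed

text \<open>Replace \<open>v\<close> by - J(J v) in \<omega>(\<Lambda>, v) and recognize dH.\<close>

lemma liouville_form_eq: "liouville_form \<omega> \<Lambda> q v = - mdiff A H q (J q v)"
  by (simp add: liouville_form_def mdiff_H J_J linear_neg[OF linear_\<omega>(1)])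

lemma mdiff_H_\<Lambda>_nonneg: "mdiff A H q (\<Lambda> q) \<ge> 0"
  by (simp add: mdiff_H metric_nonneg)

section \<open>The Liouville form and dH(\<Lambda>) in a chart\<close>

context
  fixes V and \<phi> :: "'a \<Rightarrow> 'e"
  assumes V: "(V, \<phi>) \<in> A"
begin

text \<open>\<open>JV x y\<close> is \<open>J x\<close> at the point with coordinates \<open>y\<close>, in the chart \<open>\<phi>\<close>.\<close>

definition JV :: "'e \<Rightarrow> 'e \<Rightarrow> 'e" where
  "JV x y = mdiff A \<phi> (inv_into V \<phi> y) (J (inv_into V \<phi> y) (pdiff A (inv_into V \<phi>) y x))"

lemma JV: "smooth_on (\<phi> ` V) (JV x)"
  using acs V unfolding compatible_acs_def smooth_endomorphism_def JV_def[abs_def] Let_def by fastforce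

lemma H_chart: "smooth_on (\<phi> ` V) (H \<circ> inv_into V \<phi>)"
  by (rule smooth_fun_on_UNIV[OF H_smooth V])

text \<open>The coefficients of \<lambda> are expressed by the matrix of \<open>J\<close> in the
  chart and the first derivatives of \<open>H\<close>, all of them smooth. In this form \<lambda>
  can be differentiated once more.\<close>

lemma liouville_form_chart:
  assumes "y \<in> \<phi> ` V"
  shows "liouville_form \<omega> \<Lambda> (inv_into V \<phi> y) (pdiff A (inv_into V \<phi>) y x) =
    - (\<Sum>i\<in>Basis. (JV x y \<bullet> i) * frechet_derivative (H \<circ> inv_into V \<phi>) (at y) i)"
proof -
  obtain q where q: "q \<in> V" "y = \<phi> q" using assms by blast
  have "mdiff A H q (J q (pdiff A (inv_into V \<phi>) y x)) =
      frechet_derivative (H \<circ> inv_into V \<phi>) (at y) (JV x y)"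
    using smooth_fun_mdiff[OF H_smooth V q(1)] by (simp add: q JV_def chart(5)[OF V q(1)])
  also have "\<dots> = (\<Sum>i\<in>Basis. (JV x y \<bullet> i) * frechet_derivative (H \<circ> inv_into V \<phi>) (at y) i)"
    using linear_eq_sum_Basis[OF linear_Ck_on_derivative[OF smooth_on_Ck_on[OF H_chart] assms], of "JV x y"]
    by simp
  finally have *: "mdiff A H q (J q (pdiff A (inv_into V \<phi>) y x)) =
      (\<Sum>i\<in>Basis. (JV x y \<bullet> i) * frechet_derivative (H \<circ> inv_into V \<phi>) (at y) i)" .
  have \<psi>: "inv_into V \<phi> y = q" by (simp add: q(2) chart(5)[OF V q(1)])
  show ?thesis unfolding liouville_form_eq \<psi> * ..
qed

lemma C1_liouville_form_chart:
  "Ck_on (Suc 0) (\<phi> ` V) (\<lambda>y. liouville_form \<omega> \<Lambda> (inv_into V \<phi> y) (pdiff A (inv_into V \<phi>) y x))"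
proof (rule Ck_on_cong[OF chart(2)[OF V]])
  show "Ck_on (Suc 0) (\<phi> ` V)
      (\<lambda>y. - (\<Sum>i\<in>Basis. (JV x y \<bullet> i) * frechet_derivative (H \<circ> inv_into V \<phi>) (at y) i))"
    by (intro Ck_on_1_minus Ck_on_1_sum Ck_on_1_mult Ck_on_inner_const chart(2)[OF V]
      smooth_on_Ck_on[OF JV] smooth_on_Ck_on[OF smooth_on_frechet_derivative[OF H_chart]])
qed (simp add: liouville_form_chart)

lemma continuous_mdiff_H_\<Lambda>_chart:
  "continuous_on (\<phi> ` V) (\<lambda>y. mdiff A H (inv_into V \<phi> y) (\<Lambda> (inv_into V \<phi> y)))"
proof -
  let ?\<Lambda> = "\<lambda>y. mdiff A \<phi> (inv_into V \<phi> y) (\<Lambda> (inv_into V \<phi> y))"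
  have "smooth_on (\<phi> ` V) ?\<Lambda>"
    using \<Lambda>_smooth V unfolding smooth_vector_field_def Let_def by fastforce
  then have "continuous_on (\<phi> ` V) ?\<Lambda>" using smooth_on_Ck_on[of _ _ 0] by force
  then have "continuous_on (\<phi> ` V) (\<lambda>y. frechet_derivative (H \<circ> inv_into V \<phi>) (at y) (?\<Lambda> y))"
    by (intro continuous_on_Ck_on_derivative[OF smooth_on_Ck_on[OF H_chart]]) auto
  moreover have "mdiff A H (inv_into V \<phi> y) (\<Lambda> (inv_into V \<phi> y)) =
      frechet_derivative (H \<circ> inv_into V \<phi>) (at y) (?\<Lambda> y)" if "y \<in> \<phi> ` V" for y
    using smooth_fun_mdiff[OF H_smooth V] that chart(5)[OF V] by auto
  ultimately show ?thesis by (simp cong: continuous_on_cong)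
qed

end

lemma C1_one_form_liouville: "C1_one_form A (liouville_form \<omega> \<Lambda>)"
  unfolding C1_one_form_def
  using C1_liouville_form_chart linear_\<omega>(1) by (auto simp: liouville_form_def[abs_def])

lemma continuous_mdiff_H_\<Lambda>: "continuous_on UNIV (\<lambda>q. mdiff A H q (\<Lambda> q))"
  by (rule continuous_on_charts) (rule continuous_mdiff_H_\<Lambda>_chart)

text \<open>At a critical point of \<open>H\<close> the derivatives of \<open>J\<close> drop out of \<open>\<omega> = d\<lambda> = - d(dH \<circ> J)\<close>, which leaves
  \<open>\<omega>(v, Jv) = D\<^sup>2H(v, v) + D\<^sup>2H(Jv, Jv)\<close>; at a maximum the right-hand side is nonpositive.\<close>

lemma no_local_max:
  assumes Q: "open Q" "q \<in> Q" "\<And>x. x \<in> Q \<Longrightarrow> H x \<le> H q"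
  shows False
proof -
  let ?V = "fst (chart_at A q)" let ?\<phi> = "coord_at A q" let ?y = "coord_at A q q"
  let ?\<psi> = "inv_into ?V ?\<phi>"
  note ch = chart_at[of q]
  define h where "h = H \<circ> ?\<psi>"
  define S where "S = ?\<phi> ` (?V \<inter> Q)"
  have S: "open S" "?y \<in> S" "S \<subseteq> ?\<phi> ` ?V"
    using Q ch open_chart_image[OF ch(1) Q(1)] by (auto simp: S_def)
  have "smooth_on (?\<phi> ` ?V) h" unfolding h_def by (rule H_chart[OF ch(1)])
  then have h2: "Ck_on (Suc (Suc 0)) S h" using Ck_on_subset S(3) smooth_on_Ck_on by blast
  have max: "h x \<le> h ?y" if "x \<in> S" for x
    using that Q(3) ch by (auto simp: S_def h_def chart(5)[OF ch(1)])
  note D = second_derivative_nonpos_at_local_max[OF h2 S(1,2) max]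
  \<comment> \<open>The derivative is taken along \<open>w\<close> first and then along
    \<open>v\<close>. Linearity in \<open>w\<close>, shown below, is needed because
    \<open>J q w\<close> will be inserted there.\<close>
  define D2 where "D2 v w = frechet_derivative (\<lambda>x. frechet_derivative h (at x) w) (at ?y) v" for v w
  have h1: "((\<lambda>x. frechet_derivative h (at x) w) has_derivative (\<lambda>v. D2 v w)) (at ?y)" for w
    unfolding D2_def using h2 S by (intro Ck_on_has_derivative[where S = S and k = 0]) auto
  have D2: "D2 v w = (\<Sum>i\<in>Basis. (w \<bullet> i) * D2 v i)" for v w
  proof -
    have "((\<lambda>x. \<Sum>i\<in>Basis. (w \<bullet> i) * frechet_derivative h (at x) i) has_derivative
        (\<lambda>v. \<Sum>i\<in>Basis. (w \<bullet> i) * D2 v i)) (at ?y)"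
      by (intro has_derivative_sum has_derivative_mult_right h1)
    then have "((\<lambda>x. frechet_derivative h (at x) w) has_derivative
        (\<lambda>v. \<Sum>i\<in>Basis. (w \<bullet> i) * D2 v i)) (at ?y)"
      by (rule has_derivative_transform_within_open[OF _ S(1,2)])
        (simp add: linear_eq_sum_Basis[OF linear_Ck_on_derivative[OF h2], where x = w])
    from has_derivative_unique[OF h1 this] show ?thesis by metis
  qed
  \<comment> \<open>At \<open>q\<close> the selected chart induces the identity on tangent vectors,
    so the coordinate expression of \<open>J\<close> is \<open>J q\<close> itself.\<close>
  have JV0: "JV ?V ?\<phi> w ?y = J q w" for w
    using ch pdiff_param_at[of q w]
    by (simp add: JV_def[OF ch(1)] chart(5)[OF ch(1)] mdiff_coord_at param_at_eq)
  have lf: "((\<lambda>x. liouville_form \<omega> \<Lambda> (?\<psi> x) (pdiff A ?\<psi> x w)) has_derivative (\<lambda>v. - D2 v (J q w))) (at ?y)"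
    for w
  proof -
    have JV': "(JV ?V ?\<phi> w has_derivative frechet_derivative (JV ?V ?\<phi> w) (at ?y)) (at ?y)"
      using S by (intro Ck_on_has_derivative[OF smooth_on_Ck_on[OF JV[OF ch(1)]]]) auto
    have "((\<lambda>x. - (\<Sum>i\<in>Basis. (JV ?V ?\<phi> w x \<bullet> i) * frechet_derivative h (at x) i)) has_derivative
       (\<lambda>v. - (\<Sum>i\<in>Basis. (JV ?V ?\<phi> w ?y \<bullet> i) * D2 v i +
         (frechet_derivative (JV ?V ?\<phi> w) (at ?y) v \<bullet> i) * frechet_derivative h (at ?y) i))) (at ?y)"
      by (intro has_derivative_minus has_derivative_sum has_derivative_mult has_derivative_inner_left h1 JV')
    then have "((\<lambda>x. - (\<Sum>i\<in>Basis. (JV ?V ?\<phi> w x \<bullet> i) * frechet_derivative h (at x) i)) has_derivative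
       (\<lambda>v. - D2 v (J q w))) (at ?y)"
      by (simp add: JV0 D(1) D2[of _ "J q w"])
    then show ?thesis
      by (rule has_derivative_transform_within_open[OF _ S(1,2)])
        (use S(3) in \<open>auto simp: liouville_form_chart[OF ch(1)] h_def\<close>)
  qed
  have \<omega>: "\<omega> q v w = - D2 v (J q w) + D2 w (J q v)" for v w
  proof -
    have *: "frechet_derivative (\<lambda>x. liouville_form \<omega> \<Lambda> (?\<psi> x) (pdiff A ?\<psi> x w)) (at ?y) v = - D2 v (J q w)" for v w
      by (rule fun_cong[OF frechet_derivative_at[OF lf, symmetric]])
    have "ext_deriv1 A (liouville_form \<omega> \<Lambda>) q v w = - D2 v (J q w) + D2 w (J q v)"
      by (simp add: ext_deriv1_def Let_def param_at_eq *)
    then show ?thesis by (simp only: ext_deriv_liouville)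
  qed
  have neg: "D2 v (- w) = - D2 v w" for v w
    unfolding D2[of v "- w"] D2[of v w] by (simp add: sum_negf)
  \<comment> \<open>The contradiction needs a nonzero vector; the model space has a nonempty
    basis.\<close>
  obtain v :: 'e where "v \<in> Basis" using nonempty_Basis by blast
  then have "\<omega> q v (J q v) > 0" by (intro metric_pos) (auto simp: nonzero_Basis)
  moreover have "\<omega> q v (J q v) = D2 v v + D2 (J q v) (J q v)"
    by (simp add: \<omega> J_J neg)
  moreover have "D2 v v \<le> 0" "D2 (J q v) (J q v) \<le> 0"
    using D(2)[of v] D(2)[of "J q v"] unfolding D2_def by simp_all
  ultimately show False by simp
qed

end


section \<open>Variation of the action\<close>

lemma has_vector_derivative_partial:
  assumes "(f has_derivative f') (at (s, t))"
  shows "((\<lambda>s. f (s, t)) has_vector_derivative f' (1, 0)) (at s)"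
    and "((\<lambda>t. f (s, t)) has_vector_derivative f' (0, 1)) (at t)"
proof -
  have lin: "f' (h *\<^sub>R v) = h *\<^sub>R f' v" for h v
    using has_derivative_linear[OF assms] by (rule linear_scale)
  have "((\<lambda>s. (s, t)) has_derivative (\<lambda>h. h *\<^sub>R (1, 0))) (at s)"
    by (auto intro!: derivative_eq_intros)
  from has_derivative_compose[OF this assms]
  show "((\<lambda>s. f (s, t)) has_vector_derivative f' (1, 0)) (at s)"
    unfolding has_vector_derivative_def lin .
  have "((\<lambda>t. (s, t)) has_derivative (\<lambda>h. h *\<^sub>R (0, 1))) (at t)"
    by (auto intro!: derivative_eq_intros)
  from has_derivative_compose[OF this assms]
  show "((\<lambda>t. f (s, t)) has_vector_derivative f' (0, 1)) (at t)"
    unfolding has_vector_derivative_def lin .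
qed

lemma has_real_derivative_integral_parameter:
  fixes f :: "real \<times> real \<Rightarrow> real"
  assumes f: "Ck_on (Suc 0) UNIV f"
  shows "((\<lambda>s. integral {0..1} (\<lambda>t. f (s, t))) has_real_derivative
    integral {0..1} (\<lambda>t. frechet_derivative f (at (s, t)) (1, 0))) (at s)"
proof -
  have c: "continuous_on UNIV f" using f by (rule Ck_on_1_continuous)
  have "((\<lambda>s. integral (cbox 0 1) (\<lambda>t. f (s, t))) has_vector_derivative
      integral (cbox 0 1) (\<lambda>t. frechet_derivative f (at (s, t)) (1, 0))) (at s within UNIV)"
  proof (rule leibniz_rule_vector_derivative)
    show "((\<lambda>s. f (s, t)) has_vector_derivative frechet_derivative f (at (s, t)) (1, 0)) (at s within UNIV)" for s t
      using has_vector_derivative_partial(1)[OF Ck_on_has_derivative[OF f]] by simp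
    show "(\<lambda>t. f (s, t)) integrable_on cbox 0 1" for s
      by (intro integrable_continuous continuous_on_compose2[OF c] continuous_intros) auto
    have "continuous_on UNIV (\<lambda>z. frechet_derivative f (at z) (1, 0))"
      using f by (rule Ck_on_1_continuous_derivative)
    then show "continuous_on (UNIV \<times> cbox 0 1) (\<lambda>(s, t). frechet_derivative f (at (s, t)) (1, 0))"
      unfolding case_prod_beta prod.collapse by (rule continuous_on_subset) simp
  qed auto
  then show ?thesis by (simp add: has_real_derivative_iff_has_vector_derivative)
qed

context atlas_manifold
begin

lemma
  fixes U :: "real \<times> real \<Rightarrow> 'a"
  assumes U: "smooth_plot_on A UNIV U"
  shows velocity_pdiff_1: "velocity A (\<lambda>s. U (s, t)) s = pdiff A U (s, t) (1, 0)"
    and velocity_pdiff_2: "velocity A (\<lambda>t. U (s, t)) t = pdiff A U (s, t) (0, 1)"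
  using has_vector_derivative_partial[OF smooth_plot_has_derivative(1)[OF U, of "(s, t)"]]
  by (simp_all add: velocity_def o_def vector_derivative_at)

lemma velocity_chart:
  fixes U :: "real \<times> real \<Rightarrow> 'a"
  assumes U: "smooth_plot_on A UNIV U" and V: "(V, \<phi>) \<in> A" "U (s, t) \<in> V"
  shows "velocity A (\<lambda>t. U (s, t)) t =
      pdiff A (inv_into V \<phi>) (\<phi> (U (s, t))) (vector_derivative (\<lambda>t. \<phi> (U (s, t))) (at t))"
    and "vector_derivative (\<lambda>t. \<phi> (U (s, t))) (at t) = frechet_derivative (\<phi> \<circ> U) (at (s, t)) (0, 1)"
proof -
  have "smooth_on {z \<in> UNIV. U z \<in> V} (\<phi> \<circ> U)"
    using U V(1) unfolding smooth_plot_on_def by fastforce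
  then have D: "(\<phi> \<circ> U has_derivative frechet_derivative (\<phi> \<circ> U) (at (s, t))) (at (s, t))"
    using V(2) by (intro Ck_on_has_derivative[OF smooth_on_Ck_on]) auto
  show 2: "vector_derivative (\<lambda>t. \<phi> (U (s, t))) (at t) = frechet_derivative (\<phi> \<circ> U) (at (s, t)) (0, 1)"
    using has_vector_derivative_partial(2)[OF D] by (simp add: o_def vector_derivative_at)
  have "(\<phi> \<circ> U) differentiable at (s, t)" using D unfolding differentiable_def by blast
  from pdiff_eq[OF V smooth_plot_has_derivative(2)[OF U] this]
  show "velocity A (\<lambda>t. U (s, t)) t =
      pdiff A (inv_into V \<phi>) (\<phi> (U (s, t))) (vector_derivative (\<lambda>t. \<phi> (U (s, t))) (at t))"
    unfolding velocity_pdiff_2[OF U] 2 .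
qed

lemma
  assumes f: "smooth_fun_on A UNIV f" and u: "smooth_plot_on A UNIV u"
  shows Ck_on_1_smooth_fun_plot: "Ck_on (Suc 0) UNIV (\<lambda>z. f (u z))"
    and frechet_derivative_smooth_fun_plot:
      "frechet_derivative (\<lambda>z. f (u z)) (at z) w = mdiff A f (u z) (pdiff A u z w)"
proof -
  show "Ck_on (Suc 0) UNIV (\<lambda>z. f (u z))"
  proof (rule Ck_on_1_local)
    fix z
    let ?V = "fst (chart_at A (u z))" let ?\<phi> = "coord_at A (u z)"
    note ch = chart_at[of "u z"]
    let ?N = "{x \<in> UNIV. u x \<in> ?V}"
    have N: "open ?N"
      using u chart(1)[OF ch(1)] by (auto simp: smooth_plot_on_def vimage_def[symmetric] open_vimage)
    have y: "smooth_on ?N (?\<phi> \<circ> u)" using u ch(1) unfolding smooth_plot_on_def by fastforce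
    have "Ck_on (Suc 0) ?N (\<lambda>x. (f \<circ> inv_into ?V ?\<phi>) ((?\<phi> \<circ> u) x))"
      by (rule Ck_on_1_compose[OF smooth_on_Ck_on[OF y] smooth_on_Ck_on[OF smooth_fun_on_UNIV[OF f ch(1)]]])
        auto
    then have "Ck_on (Suc 0) ?N (\<lambda>z. f (u z))"
      by (rule Ck_on_cong[OF N, rotated]) (simp add: chart(5)[OF ch(1)])
    with N ch(2) show "\<exists>T. open T \<and> z \<in> T \<and> Ck_on (Suc 0) T (\<lambda>z. f (u z))" by blast
  qed
  have "(f \<circ> u has_derivative (\<lambda>w. mdiff A f (u z) (pdiff A u z w))) (at z)"
    by (intro compose_has_derivative smooth_fun_has_derivative[OF f] smooth_plot_has_derivative[OF u])
  then show "frechet_derivative (\<lambda>z. f (u z)) (at z) w = mdiff A f (u z) (pdiff A u z w)"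
    unfolding o_def by (intro fun_cong[OF frechet_derivative_at[symmetric]])
qed

text \<open>First variation. Differentiating under the integral produces the s-derivative of
  \<alpha>(U_t). It differs from d\<alpha>(U_s, U_t) by the t-derivative of \<alpha>(U_s), whose
  integral over a full period is zero.\<close>

lemma has_real_derivative_integral_one_form:
  fixes U :: "real \<times> real \<Rightarrow> 'a"
  assumes \<alpha>: "C1_one_form A \<alpha>" and U: "smooth_plot_on A UNIV U"
    and per: "\<And>s t. U (s, t + 1) = U (s, t)"
  shows "(\<lambda>t. ext_deriv1 A \<alpha> (U (s, t)) (pdiff A U (s, t) (1, 0)) (pdiff A U (s, t) (0, 1)))
      integrable_on {0..1}"
    and "((\<lambda>s. integral {0..1} (\<lambda>t. \<alpha> (U (s, t)) (velocity A (\<lambda>t. U (s, t)) t))) has_real_derivative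
      integral {0..1} (\<lambda>t. ext_deriv1 A \<alpha> (U (s, t)) (pdiff A U (s, t) (1, 0)) (pdiff A U (s, t) (0, 1)))) (at s)"
proof -
  let ?\<omega> = "\<lambda>t. ext_deriv1 A \<alpha> (U (s, t)) (pdiff A U (s, t) (1, 0)) (pdiff A U (s, t) (0, 1))"
  define G where "G d z = \<alpha> (U z) (pdiff A U z d)" for d z
  have G: "Ck_on (Suc 0) UNIV (G d)" for d
    unfolding G_def[abs_def] by (rule Ck_on_1_pullback[OF \<alpha> U])
  define DG where "DG d c t = frechet_derivative (G d) (at (s, t)) c" for d c t
  have cont: "continuous_on {0..1} (DG d c)" for d c
    unfolding DG_def[abs_def]
    by (rule continuous_on_compose2[OF Ck_on_1_continuous_derivative[OF G]]) (auto intro!: continuous_intros)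
  note int = integrable_continuous_real[OF cont]
  have eq: "?\<omega> = (\<lambda>t. DG (0, 1) (1, 0) t - DG (1, 0) (0, 1) t)"
    unfolding DG_def G_def[abs_def] by (simp only: ext_deriv1_pullback[OF \<alpha> U])
  show "?\<omega> integrable_on {0..1}" unfolding eq by (intro integrable_diff int)
  have "(DG (1, 0) (0, 1) has_integral G (1, 0) (s, 1) - G (1, 0) (s, 0)) {0..1}"
  proof (rule fundamental_theorem_of_calculus)
    show "((\<lambda>t. G (1, 0) (s, t)) has_vector_derivative DG (1, 0) (0, 1) t) (at t within {0..1})" for t
      unfolding DG_def
      by (rule has_vector_derivative_at_within[OF has_vector_derivative_partial(2)[OF Ck_on_has_derivative[OF G UNIV_I]]])
  qed simp
  \<comment> \<open>The vectors \<open>pdiff A U (s, 1) (1, 0)\<close> and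
    \<open>pdiff A U (s, 0) (1, 0)\<close> are velocities of the same curve in \<open>s\<close>, by
    periodicity.\<close>
  moreover have "G (1, 0) (s, 1) = G (1, 0) (s, 0)"
    using per[of _ 0] by (simp add: G_def velocity_pdiff_1[OF U, symmetric])
  ultimately have "integral {0..1} (DG (1, 0) (0, 1)) = 0" by (simp add: integral_unique)
  then have "integral {0..1} ?\<omega> = integral {0..1} (DG (0, 1) (1, 0))"
    unfolding eq by (simp add: integral_diff int)
  then show "((\<lambda>s. integral {0..1} (\<lambda>t. \<alpha> (U (s, t)) (velocity A (\<lambda>t. U (s, t)) t))) has_real_derivative
      integral {0..1} ?\<omega>) (at s)"
    using has_real_derivative_integral_parameter[OF G[of "(0, 1)"], of s]
    by (simp add: G_def velocity_pdiff_2[OF U] DG_def[abs_def])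
qed

end

context liouville_gradient
begin

lemma flow_lineD:
  assumes "u \<in> flow_lines A p \<omega> J H xm xp"
  shows "smooth_plot_on A UNIV (\<lambda>(s, t). u s t)" "\<And>s t. u s (t + 1) = u s t"
    "\<And>s. mean_value H (u s) = 0" "c1_converges A u xm at_bot" "c1_converges A u xp at_top"
    and "\<And>s t. velocity A (\<lambda>s. u s t) s =
      - (J (u s t) (velocity A (u s) t) + constraint_factor A \<omega> J H (u s) *\<^sub>R \<Lambda> (u s t))"
  using assms
  by (auto simp: flow_lines_def constraint_set_def w1p_loops_def action_gradient_def gradient_eq)

text \<open>By the first variation the action changes at the rate of minus the integral of
  \<omega>(u_s, u_t). Solving the flow equation for u_t turns the integrand into |u_s|^2 + \<chi>
  dH(u_s), so the rate is minus the squared L^2-norm of u_s.\<close>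

lemma action_flow_line_antimono:
  assumes u: "u \<in> flow_lines A p \<omega> J H xm xp" and le: "s \<le> s'"
  shows "action A (liouville_form \<omega> \<Lambda>) (u s') \<le> action A (liouville_form \<omega> \<Lambda>) (u s)"
proof (rule DERIV_nonpos_imp_nonincreasing[OF le])
  fix s
  define U where "U = (\<lambda>(s, t). u s t)"
  have U: "smooth_plot_on A UNIV U" and per: "U (s, t + 1) = U (s, t)" for s t
    using flow_lineD[OF u] by (auto simp: U_def)
  have Ust: "U (s, t) = u s t" for s t by (simp add: U_def)
  let ?\<chi> = "constraint_factor A \<omega> J H (u s)"
  define X where "X t = pdiff A U (s, t) (1, 0)" for t
  define T where "T t = pdiff A U (s, t) (0, 1)" for t
  have vel: "velocity A (\<lambda>s. u s t) s = pdiff A U (s, t) (1, 0)"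
    "velocity A (u s) t = pdiff A U (s, t) (0, 1)" for s t
    using velocity_pdiff_1[OF U, of t s] velocity_pdiff_2[OF U, of s t] by (simp_all add: Ust)
  note D = has_real_derivative_integral_one_form[OF C1_one_form_liouville U per, of s,
    unfolded ext_deriv_liouville, folded X_def T_def]
  have X: "X t = - (J (u s t) (T t) + ?\<chi> *\<^sub>R \<Lambda> (u s t))" for t
    using flow_lineD(6)[OF u, of t s] by (simp add: X_def T_def vel)
  \<comment> \<open>The term with \<open>\<chi>\<close> integrates to zero since \<open>h(u(s))\<close> is constant.\<close>
  have \<omega>XT: "\<omega> (U (s, t)) (X t) (T t) =
      \<omega> (u s t) (X t) (J (u s t) (X t)) + ?\<chi> * mdiff A H (u s t) (X t)" for t
  proof -
    let ?q = "u s t"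
    have "J ?q (X t) = T t - ?\<chi> *\<^sub>R J ?q (\<Lambda> ?q)"
      unfolding X by (simp add: linear_neg[OF linear_J] linear_diff[OF linear_J]
        linear_scale[OF linear_J] J_J)
    then have "\<omega> ?q (X t) (J ?q (X t)) = \<omega> ?q (X t) (T t) - ?\<chi> * \<omega> ?q (X t) (J ?q (\<Lambda> ?q))"
      by (simp add: linear_diff[OF linear_\<omega>(1)] linear_scale[OF linear_\<omega>(1)])
    then show ?thesis by (simp add: mdiff_H metric_sym[of ?q "X t" "\<Lambda> ?q"] Ust)
  qed
  have H: "Ck_on (Suc 0) UNIV (\<lambda>z. H (U z))" by (rule Ck_on_1_smooth_fun_plot[OF H_smooth U])
  have dH: "(\<lambda>t. mdiff A H (u s t) (X t)) = (\<lambda>t. frechet_derivative (\<lambda>z. H (U z)) (at (s, t)) (1, 0))"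
    by (simp add: frechet_derivative_smooth_fun_plot[OF H_smooth U] X_def Ust)
  have intH: "(\<lambda>t. mdiff A H (u s t) (X t)) integrable_on {0..1}"
    unfolding dH
    by (intro integrable_continuous_real continuous_on_compose2[OF Ck_on_1_continuous_derivative[OF H]]
      continuous_intros) auto
  have "((\<lambda>s. mean_value H (u s)) has_real_derivative integral {0..1} (\<lambda>t. mdiff A H (u s t) (X t))) (at s)"
    using has_real_derivative_integral_parameter[OF H, of s]
    by (simp add: dH mean_value_def Ust)
  \<comment> \<open>This integral is the derivative in \<open>s\<close> of the mean value of
    \<open>H\<close>, which is 0 for every \<open>s\<close>.\<close>
  then have "integral {0..1} (\<lambda>t. mdiff A H (u s t) (X t)) = 0"
    using flow_lineD(3)[OF u] DERIV_const_ratio_const DERIV_unique[OF _ DERIV_const[of 0]] by simp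
  then have zero: "integral {0..1} (\<lambda>t. ?\<chi> * mdiff A H (u s t) (X t)) = 0" by simp
  have "0 \<le> integral {0..1} (\<lambda>t. \<omega> (U (s, t)) (X t) (T t) - ?\<chi> * mdiff A H (u s t) (X t))"
    by (intro integral_nonneg integrable_diff D(1) integrable_on_mult_right intH)
      (simp add: \<omega>XT metric_nonneg)
  also have "\<dots> = integral {0..1} (\<lambda>t. \<omega> (U (s, t)) (X t) (T t))"
    using zero by (subst integral_diff) (auto intro: D(1) intH integrable_on_mult_right)
  finally have "- integral {0..1} (\<lambda>t. \<omega> (U (s, t)) (X t) (T t)) \<le> 0" by simp
  moreover have "((\<lambda>s. action A (liouville_form \<omega> \<Lambda>) (u s)) has_real_derivative
      - integral {0..1} (\<lambda>t. \<omega> (U (s, t)) (X t) (T t))) (at s)"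
    using DERIV_minus[OF D(2)] by (simp add: action_def Ust)
  ultimately show "\<exists>y. ((\<lambda>s. action A (liouville_form \<omega> \<Lambda>) (u s)) has_real_derivative y) (at s) \<and> y \<le> 0"
    by blast
qed

end


section \<open>A priori bounds from convergence\<close>

context atlas_manifold
begin

text \<open>Over a short interval the loops lie in the chart at \<open>x t0\<close>. The
  coefficients of \<alpha> are bounded on a compact coordinate ball, and the coordinate velocities
  are uniformly close to that of \<open>x\<close>, so the bound is governed by \<open>x\<close> and
  not by \<open>u\<close>. The role of \<open>u0\<close> is to make the velocity of \<open>x\<close>
  bounded: \<open>x\<close> is only assumed continuous, but its coordinate velocity is a uniform
  limit of the continuous ones of \<open>u0\<close>.\<close>

lemma c1_converges_bounded_locally:
  fixes u0 :: "real \<Rightarrow> real \<Rightarrow> 'a"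
  assumes \<alpha>: "C1_one_form A \<alpha>" and F: "F \<noteq> bot" and x: "continuous_on UNIV x"
    and u0: "smooth_plot_on A UNIV (\<lambda>(s, t). u0 s t)" "c1_converges A u0 x F"
  shows "\<exists>d>0. \<exists>B. \<forall>u. smooth_plot_on A UNIV (\<lambda>(s, t). u s t) \<longrightarrow> c1_converges A u x F \<longrightarrow>
    (\<forall>\<^sub>F s in F. \<forall>t\<in>{t0 - d..t0 + d}. \<bar>\<alpha> (u s t) (velocity A (u s) t)\<bar> \<le> B)"
proof -
  let ?V = "fst (chart_at A (x t0))" let ?\<phi> = "coord_at A (x t0)" let ?\<psi> = "inv_into ?V ?\<phi>"
  note ch = chart_at[of "x t0"]
  let ?a = "\<lambda>i y. \<alpha> (?\<psi> y) (pdiff A ?\<psi> y i)"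
  have "?\<phi> (x t0) \<in> ?\<phi> ` ?V" using ch(2) by blast
  then obtain r where r: "r > 0" "cball (?\<phi> (x t0)) r \<subseteq> ?\<phi> ` ?V"
    using chart(2)[OF ch(1)] open_contains_cball by blast
  let ?K = "cball (?\<phi> (x t0)) r"
  have cont_a: "continuous_on ?K (?a i)" for i
  proof -
    have "Ck_on (Suc 0) (?\<phi> ` ?V) (?a i)" using \<alpha> ch(1) unfolding C1_one_form_def by fastforce
    from continuous_on_subset[OF Ck_on_1_continuous[OF this] r(2)] show ?thesis .
  qed
  have "compact ((\<lambda>y. \<Sum>i\<in>Basis. \<bar>?a i y\<bar>) ` ?K)"
    by (intro compact_continuous_image continuous_on_sum continuous_on_rabs cont_a compact_cball)
  from compact_imp_bounded[OF this] obtain B1 where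
    B1: "\<And>y. y \<in> ?K \<Longrightarrow> \<bar>\<Sum>i\<in>Basis. \<bar>?a i y\<bar>\<bar> \<le> B1"
    unfolding bounded_iff ball_simps real_norm_def by blast
  have xV: "isCont (?\<phi> \<circ> x) t0" "isCont x t0"
  proof -
    show "isCont x t0" using x by (simp add: continuous_on_eq_continuous_at)
    moreover have "isCont ?\<phi> (x t0)"
      using chart(1,3)[OF ch(1)] ch(2) by (simp add: continuous_on_eq_continuous_at)
    ultimately show "isCont (?\<phi> \<circ> x) t0" by (rule continuous_at_compose)
  qed
  \<comment> \<open>The other half of \<open>r\<close> is reserved for the distance between
    \<open>u s\<close> and \<open>x\<close>.\<close>
  obtain d1 where d1: "d1 > 0" "\<And>t. dist t t0 < d1 \<Longrightarrow> dist (?\<phi> (x t)) (?\<phi> (x t0)) < r / 2"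
    using xV(1) r(1) unfolding continuous_at_eps_delta by (auto dest: spec[of _ "r / 2"])
  obtain T where T: "open T" "t0 \<in> T" "\<And>t. t \<in> T \<Longrightarrow> x t \<in> ?V"
    using xV(2)[unfolded continuous_at_open, rule_format, OF conjI, OF chart(1)[OF ch(1)] ch(2)] by blast
  then obtain d2 where d2: "d2 > 0" "ball t0 d2 \<subseteq> T" using openE by blast
  define d where "d = min d1 d2 / 2"
  have d: "d > 0" "d < d1" "d < d2" using d1 d2 by (auto simp: d_def)
  let ?I = "{t0 - d..t0 + d}"
  have I: "dist (?\<phi> (x t)) (?\<phi> (x t0)) < r / 2" "x t \<in> ?V" if "t \<in> ?I" for t
  proof -
    have "dist t t0 \<le> d" using that by (auto simp: dist_real_def)
    then show "dist (?\<phi> (x t)) (?\<phi> (x t0)) < r / 2" using d by (intro d1(2)) simp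
    show "x t \<in> ?V" using \<open>dist t t0 \<le> d\<close> d d2 by (intro T(3)) (auto simp: dist_commute)
  qed
  have conv: "\<forall>\<^sub>F s in F. u s ` ?I \<subseteq> ?V" "uniform_limit ?I (\<lambda>s. ?\<phi> \<circ> u s) (?\<phi> \<circ> x) F"
    "uniform_limit ?I (\<lambda>s t. vector_derivative (?\<phi> \<circ> u s) (at t)) (\<lambda>t. vector_derivative (?\<phi> \<circ> x) (at t)) F"
    if "c1_converges A u x F" for u
  proof -
    have *: "t0 - d < t0 + d \<and> x ` ?I \<subseteq> ?V" using d I by auto
    show "\<forall>\<^sub>F s in F. u s ` ?I \<subseteq> ?V" "uniform_limit ?I (\<lambda>s. ?\<phi> \<circ> u s) (?\<phi> \<circ> x) F"
      "uniform_limit ?I (\<lambda>s t. vector_derivative (?\<phi> \<circ> u s) (at t)) (\<lambda>t. vector_derivative (?\<phi> \<circ> x) (at t)) F"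
      using that[unfolded c1_converges_def, rule_format, OF ch(1), unfolded prod.case, rule_format, OF *] by auto
  qed
  let ?w = "\<lambda>t. vector_derivative (?\<phi> \<circ> x) (at t)"
  have "continuous_on ?I ?w"
  proof (rule uniform_limit_theorem[OF _ conv(3)[OF u0(2)] F])
    show "\<forall>\<^sub>F s in F. continuous_on ?I (\<lambda>t. vector_derivative (?\<phi> \<circ> u0 s) (at t))"
    proof (rule eventually_mono[OF conv(1)[OF u0(2)]])
      fix s assume sub: "u0 s ` ?I \<subseteq> ?V"
      define U where "U = (\<lambda>(s, t). u0 s t)"
      have U: "smooth_plot_on A UNIV U" and Ust: "U (s, t) = u0 s t" for s t
        using u0(1) by (simp_all add: U_def)
      let ?N = "{z \<in> UNIV. U z \<in> ?V}"
      have "smooth_on ?N (?\<phi> \<circ> U)" using U ch(1) unfolding smooth_plot_on_def by fastforce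
      then have "continuous_on ?N (\<lambda>z. frechet_derivative (?\<phi> \<circ> U) (at z) (0, 1))"
        by (intro Ck_on_1_continuous_derivative smooth_on_Ck_on)
      then have "continuous_on ?I (\<lambda>t. frechet_derivative (?\<phi> \<circ> U) (at (s, t)) (0, 1))"
        by (rule continuous_on_compose2) (use sub in \<open>auto simp: U_def intro!: continuous_intros\<close>)
      then show "continuous_on ?I (\<lambda>t. vector_derivative (?\<phi> \<circ> u0 s) (at t))"
      proof (rule continuous_on_eq)
        show "frechet_derivative (?\<phi> \<circ> U) (at (s, t)) (0, 1) = vector_derivative (?\<phi> \<circ> u0 s) (at t)"
          if "t \<in> ?I" for t
          using velocity_chart(2)[OF U ch(1), of s t] subsetD[OF sub imageI[OF that]]
          by (simp add: Ust o_def)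
      qed
    qed
  qed
  then have "compact (?w ` ?I)" by (intro compact_continuous_image compact_Icc)
  from compact_imp_bounded[OF this] obtain B2 where B2: "\<And>t. t \<in> ?I \<Longrightarrow> norm (?w t) \<le> B2"
    unfolding bounded_iff ball_simps real_norm_def by blast
  \<comment> \<open>\<open>B2 + 1\<close> bounds the coordinate velocity of \<open>u s\<close> once
    it is within 1 of that of \<open>x\<close>; \<open>B1\<close> bounds the sum of the absolute
    values of the coefficients of \<alpha>.\<close>
  have "\<forall>\<^sub>F s in F. \<forall>t\<in>?I. \<bar>\<alpha> (u s t) (velocity A (u s) t)\<bar> \<le> (B2 + 1) * B1"
    if u: "smooth_plot_on A UNIV (\<lambda>(s, t). u s t)" "c1_converges A u x F" for u
  proof -
    define U where "U = (\<lambda>(s, t). u s t)"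
    have U: "smooth_plot_on A UNIV U" and Ust: "U (s, t) = u s t" for s t using u(1) by (simp_all add: U_def)
    have near: "\<forall>\<^sub>F s in F. \<forall>t\<in>?I. dist ((?\<phi> \<circ> u s) t) ((?\<phi> \<circ> x) t) < r / 2"
      "\<forall>\<^sub>F s in F. \<forall>t\<in>?I. dist (vector_derivative (?\<phi> \<circ> u s) (at t)) (?w t) < 1"
      using uniform_limitD[OF conv(2)[OF u(2)], of "r / 2"] uniform_limitD[OF conv(3)[OF u(2)], of 1] r(1)
      by simp_all
    from conv(1)[OF u(2)] near show ?thesis
    proof eventually_elim
      case (elim s)
      show ?case
      proof
        fix t assume t: "t \<in> ?I"
        have V: "u s t \<in> ?V" using elim(1) t by blast
        let ?y = "?\<phi> (u s t)" let ?v = "vector_derivative (?\<phi> \<circ> u s) (at t)"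
        have "dist ?y (?\<phi> (x t0)) < r"
          using elim(2)[rule_format, OF t] I(1)[OF t] dist_triangle[of ?y "?\<phi> (x t0)" "?\<phi> (x t)"] by simp
        then have y: "?y \<in> ?K" by (simp add: dist_commute)
        have "norm ?v \<le> norm (?w t) + norm (?v - ?w t)" by (rule norm_triangle_sub)
        then have v: "norm ?v \<le> B2 + 1"
          using elim(3)[rule_format, OF t] B2[OF t] by (simp add: dist_norm)
        have "\<alpha> (u s t) (velocity A (u s) t) = \<alpha> (u s t) (pdiff A ?\<psi> ?y ?v)"
          using velocity_chart(1)[OF U ch(1), of s t] V by (simp add: Ust o_def)
        also have "\<dots> = (\<Sum>i\<in>Basis. (?v \<bullet> i) * ?a i ?y)"
          using one_form_coordinates[OF \<alpha> ch(1) V, of ?v] chart(5)[OF ch(1) V] by simp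
        finally have "\<bar>\<alpha> (u s t) (velocity A (u s) t)\<bar> \<le> (\<Sum>i\<in>Basis. \<bar>(?v \<bullet> i) * ?a i ?y\<bar>)"
          by (simp only: sum_abs)
        also have "\<dots> \<le> (\<Sum>i\<in>Basis. norm ?v * \<bar>?a i ?y\<bar>)"
          unfolding abs_mult by (intro sum_mono mult_right_mono Basis_le_norm) auto
        also have "\<dots> = norm ?v * (\<Sum>i\<in>Basis. \<bar>?a i ?y\<bar>)" by (rule sum_distrib_left[symmetric])
        also have "\<dots> \<le> (B2 + 1) * B1"
        proof (rule mult_mono[OF v])
          show "(\<Sum>i\<in>Basis. \<bar>?a i ?y\<bar>) \<le> B1" using B1[OF y] by linarith
          show "0 \<le> B2 + 1" using v norm_ge_zero[of ?v] by linarith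
        qed (rule sum_nonneg, rule abs_ge_zero)
        finally show "\<bar>\<alpha> (u s t) (velocity A (u s) t)\<bar> \<le> (B2 + 1) * B1" .
      qed
    qed
  qed
  with d(1) show ?thesis by blast
qed

text \<open>Bisection glues the local bounds into one over a period. The bound is chosen before
  \<open>u\<close>, whereas the threshold in \<open>s\<close> may depend on \<open>u\<close>;
  joining two intervals takes the larger bound and intersects the two events.\<close>

lemma c1_converges_bounded:
  fixes u0 :: "real \<Rightarrow> real \<Rightarrow> 'a"
  assumes \<alpha>: "C1_one_form A \<alpha>" and F: "F \<noteq> bot" and x: "continuous_on UNIV x"
    and u0: "smooth_plot_on A UNIV (\<lambda>(s, t). u0 s t)" "c1_converges A u0 x F"
  shows "\<exists>B. \<forall>u. smooth_plot_on A UNIV (\<lambda>(s, t). u s t) \<longrightarrow> c1_converges A u x F \<longrightarrow>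
    (\<forall>\<^sub>F s in F. \<forall>t\<in>{0..1}. \<bar>\<alpha> (u s t) (velocity A (u s) t)\<bar> \<le> B)"
proof -
  define P where "P a b \<longleftrightarrow> (\<exists>B. \<forall>u. smooth_plot_on A UNIV (\<lambda>(s, t). u s t) \<longrightarrow> c1_converges A u x F \<longrightarrow>
    (\<forall>\<^sub>F s in F. \<forall>t\<in>{a..b}. \<bar>\<alpha> (u s t) (velocity A (u s) t)\<bar> \<le> B))" for a b
  have "P 0 1"
  proof (rule Bolzano)
    fix a b c :: real assume "P a b" "P b c" "a \<le> b" "b \<le> c"
    obtain B1 B2 where
      B1: "\<And>u. smooth_plot_on A UNIV (\<lambda>(s, t). u s t) \<Longrightarrow> c1_converges A u x F \<Longrightarrow>
        \<forall>\<^sub>F s in F. \<forall>t\<in>{a..b}. \<bar>\<alpha> (u s t) (velocity A (u s) t)\<bar> \<le> B1" and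
      B2: "\<And>u. smooth_plot_on A UNIV (\<lambda>(s, t). u s t) \<Longrightarrow> c1_converges A u x F \<Longrightarrow>
        \<forall>\<^sub>F s in F. \<forall>t\<in>{b..c}. \<bar>\<alpha> (u s t) (velocity A (u s) t)\<bar> \<le> B2"
      using \<open>P a b\<close> \<open>P b c\<close> unfolding P_def by blast
    show "P a c"
      unfolding P_def
    proof (intro exI[of _ "max B1 B2"] allI impI)
      fix u assume u: "smooth_plot_on A UNIV (\<lambda>(s, t). u s t)" "c1_converges A u x F"
      from B1[OF u] B2[OF u]
      show "\<forall>\<^sub>F s in F. \<forall>t\<in>{a..c}. \<bar>\<alpha> (u s t) (velocity A (u s) t)\<bar> \<le> max B1 B2"
      proof eventually_elim
        case (elim s)
        have "t \<in> {a..b} \<or> t \<in> {b..c}" if "t \<in> {a..c}" for t using that by auto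
        with elim show ?case by (meson max.coboundedI1 max.coboundedI2)
      qed
    qed
  next
    fix t0 :: real
    obtain d B where d: "d > 0" and B: "\<And>u. smooth_plot_on A UNIV (\<lambda>(s, t). u s t) \<Longrightarrow> c1_converges A u x F \<Longrightarrow>
        \<forall>\<^sub>F s in F. \<forall>t\<in>{t0 - d..t0 + d}. \<bar>\<alpha> (u s t) (velocity A (u s) t)\<bar> \<le> B"
      using c1_converges_bounded_locally[OF assms, of t0] by blast
    have "P a b" if "a \<le> t0" "t0 \<le> b" "b - a < d" for a b
    proof -
      have "{a..b} \<subseteq> {t0 - d..t0 + d}" using that by auto
      then show ?thesis
        unfolding P_def by (intro exI[of _ B] allI impI) (auto intro!: eventually_mono[OF B])
    qed
    with d show "\<exists>d>0. \<forall>a b. a \<le> t0 \<and> t0 \<le> b \<and> b - a < d \<longrightarrow> P a b" by blast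
  qed simp
  then show ?thesis unfolding P_def .
qed

text \<open>The action integrates over an interval of length 1, so it inherits the bound on its
  integrand, which is continuous by the regularity of pullbacks.\<close>

lemma action_bounded_near_limit:
  fixes u0 :: "real \<Rightarrow> real \<Rightarrow> 'a"
  assumes \<alpha>: "C1_one_form A \<alpha>" and F: "F \<noteq> bot" and x: "continuous_on UNIV x"
    and u0: "smooth_plot_on A UNIV (\<lambda>(s, t). u0 s t)" "c1_converges A u0 x F"
  shows "\<exists>B. \<forall>u. smooth_plot_on A UNIV (\<lambda>(s, t). u s t) \<longrightarrow> c1_converges A u x F \<longrightarrow>
    (\<forall>\<^sub>F s in F. \<bar>action A \<alpha> (u s)\<bar> \<le> B)"
proof -
  obtain B where B: "\<And>u. smooth_plot_on A UNIV (\<lambda>(s, t). u s t) \<Longrightarrow> c1_converges A u x F \<Longrightarrow>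
      \<forall>\<^sub>F s in F. \<forall>t\<in>{0..1}. \<bar>\<alpha> (u s t) (velocity A (u s) t)\<bar> \<le> B"
    using c1_converges_bounded[OF assms] by blast
  have "\<forall>\<^sub>F s in F. \<bar>action A \<alpha> (u s)\<bar> \<le> B"
    if u: "smooth_plot_on A UNIV (\<lambda>(s, t). u s t)" "c1_converges A u x F" for u
  proof (rule eventually_mono[OF B[OF u]])
    fix s assume s: "\<forall>t\<in>{0..1}. \<bar>\<alpha> (u s t) (velocity A (u s) t)\<bar> \<le> B"
    define U where "U = (\<lambda>(s, t). u s t)"
    have U: "smooth_plot_on A UNIV U" and Ust: "U (s, t) = u s t" for s t using u(1) by (simp_all add: U_def)
    have vel: "velocity A (u s) t = pdiff A U (s, t) (0, 1)" for t
      using velocity_pdiff_2[OF U, of s t] by (simp add: Ust)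
    have "continuous_on {0..1} (\<lambda>t. \<alpha> (U (s, t)) (pdiff A U (s, t) (0, 1)))"
      by (rule continuous_on_compose2[OF Ck_on_1_continuous[OF Ck_on_1_pullback[OF \<alpha> U]]])
        (auto intro!: continuous_intros)
    then have "continuous_on {0..1} (\<lambda>t. \<alpha> (u s t) (velocity A (u s) t))"
      unfolding vel Ust .
    from integral_bound[OF _ this, of B] s show "\<bar>action A \<alpha> (u s)\<bar> \<le> B"
      by (simp add: action_def)
  qed
  then show ?thesis by blast
qed

end


section \<open>The constraint factor\<close>

context liouville_gradient
begin

text \<open>Two regions determine \<delta>. On \<open>U\<close> one has dH(\<Lambda>) = e^r = H + 1,
  a gap of exactly 1. On the compact set \<open>W - U\<close> the inequality dH(\<Lambda>) \<ge> 0
  leaves a gap of minus the maximum of \<open>H\<close> there. The conclusion does not mention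
  \<open>J\<close>, so a \<delta> found with one \<open>J\<close> serves all of them.\<close>

lemma mdiff_H_\<Lambda>_gap:
  assumes completion: "liouville_completion A W \<omega> \<Lambda> \<epsilon> U F r \<pi>"
    and reeb: "reeb_field A (frontier W) \<omega> (liouville_form \<omega> \<Lambda>) U r \<pi> R"
    and zero: "frontier W = {q. H q = 0}"
    and J_\<Lambda>: "\<And>q. q \<in> U \<Longrightarrow> J q (\<Lambda> q) = R q"
  shows "\<exists>\<delta>>0. \<forall>q. H q + \<delta> \<le> mdiff A H q (\<Lambda> q)"
proof -
  note c = completion[unfolded liouville_completion_def Let_def]
  have "compact W" using c by (simp add: liouville_domain_def)
  have cover: "W \<union> {q \<in> U. r q \<ge> 0} = UNIV" and inter: "W \<inter> {q \<in> U. r q \<ge> 0} = frontier W"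
    and "\<epsilon> > 0" "open U" and F0: "\<And>x. x \<in> frontier W \<Longrightarrow> F 0 x = x"
    and F_vel: "\<And>x s. x \<in> frontier W \<Longrightarrow> s > - \<epsilon> \<Longrightarrow> has_velocity A (\<lambda>s. F s x) s (\<Lambda> (F s x))"
    and F_coord: "\<And>x s. x \<in> frontier W \<Longrightarrow> s > - \<epsilon> \<Longrightarrow> F s x \<in> U \<and> r (F s x) = s"
    and U: "\<And>q. q \<in> U \<Longrightarrow> r q > - \<epsilon> \<and> \<pi> q \<in> frontier W \<and> F (r q) (\<pi> q) = q"
    and lf: "\<And>q v. q \<in> U \<Longrightarrow> liouville_form \<omega> \<Lambda> q v = exp (r q) * liouville_form \<omega> \<Lambda> (\<pi> q) (tdiff A \<pi> q v)"
    using c by blast+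
  have frontier_U: "frontier W \<subseteq> U"
  proof
    fix x assume x: "x \<in> frontier W"
    show "x \<in> U" using F_coord[OF x, of 0] F0[OF x] \<open>\<epsilon> > 0\<close> by simp
  qed
  \<comment> \<open>Here J \<Lambda> = R; \<open>R\<close> is independent of \<open>r\<close>,
    \<lambda> scales by e^r, and \<lambda>(R) = 1 on the boundary.\<close>
  have dH: "mdiff A H q (\<Lambda> q) = exp (r q)" if q: "q \<in> U" for q
  proof -
    have "mdiff A H q (\<Lambda> q) = liouville_form \<omega> \<Lambda> q (R q)"
      by (simp add: mdiff_H J_\<Lambda>[OF q] liouville_form_def)
    also have "\<dots> = exp (r q) * liouville_form \<omega> \<Lambda> (\<pi> q) (R (\<pi> q))"
      using reeb q by (simp add: lf[OF q] reeb_field_def)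
    also have "\<dots> = exp (r q)" using reeb U[OF q] by (simp add: reeb_field_def)
    finally show ?thesis .
  qed
  have H: "H q = exp (r q) - 1" if q: "q \<in> U" for q
  proof -
    have x: "\<pi> q \<in> frontier W" and rq: "r q > - \<epsilon>" using U[OF q] by auto
    \<comment> \<open>Along a flow line of \<Lambda> the functions \<open>H\<close> and e^s have the
      same derivative. The constant is read off at \<open>s = 0\<close>, where the flow line meets
      the boundary and \<open>H\<close> vanishes.\<close>
    have "\<exists>k. \<forall>s\<in>{- \<epsilon><..}. H (F s (\<pi> q)) - exp s = k"
    proof (rule has_field_derivative_zero_constant)
      fix s assume s: "s \<in> {- \<epsilon><..}"
      have "((\<lambda>s. H (F s (\<pi> q))) has_real_derivative exp s) (at s)"
        using has_velocity_compose[OF H_smooth F_vel[OF x], of s] s F_coord[OF x, of s]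
        by (simp add: dH has_real_derivative_iff_has_vector_derivative o_def)
      from DERIV_diff[OF this DERIV_exp]
      show "((\<lambda>s. H (F s (\<pi> q)) - exp s) has_real_derivative 0) (at s within {- \<epsilon><..})"
        by (auto intro: has_field_derivative_at_within)
    qed (simp add: convex_real_interval)
    then obtain k where k: "H (F s (\<pi> q)) - exp s = k" if "s > - \<epsilon>" for s by auto
    have "H (\<pi> q) = 0" using x zero by blast
    with k[of 0] F0[OF x] \<open>\<epsilon> > 0\<close> have "k = -1" by simp
    with k[OF rq] U[OF q] show ?thesis by simp
  qed
  define Q where "Q = W - U"
  have "compact Q" unfolding Q_def using \<open>compact W\<close> \<open>open U\<close> by (rule compact_diff)
  have cont: "continuous_on Q H" using continuous_smooth_fun[OF H_smooth] continuous_on_subset by blast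
  have outside: "q \<in> Q" if "q \<notin> U" for q using that cover unfolding Q_def by blast
  show ?thesis
  proof (cases "Q = {}")
    case True
    then have "q \<in> U" for q using outside by blast
    then show ?thesis by (intro exI[of _ 1]) (simp add: dH H)
  next
    case False
    from continuous_attains_sup[OF \<open>compact Q\<close> this cont] obtain q0 where
      q0: "q0 \<in> Q" "\<And>q. q \<in> Q \<Longrightarrow> H q \<le> H q0" by blast
    \<comment> \<open>A nonnegative maximum on \<open>Q\<close> would be a maximum over all of
      \<open>interior W\<close>, because \<open>H\<close> is negative at interior points lying in
      \<open>U\<close>. Since the boundary is contained in \<open>U\<close>, the point
      \<open>q0\<close> is interior, so it would be a local maximum.\<close>
    have neg: "H q0 < 0"
    proof (rule ccontr)
      assume "\<not> H q0 < 0"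
      have le: "H x \<le> H q0" if "x \<in> interior W" for x
      proof (cases "x \<in> U")
        case True
        have "x \<notin> frontier W" using that by (simp add: frontier_def)
        \<comment> \<open>Otherwise \<open>x\<close> would lie both in \<open>W\<close> and in the
          cylindrical end, that is, on the boundary.\<close>
        then have "r x < 0" using True that inter interior_subset[of W] by fastforce
        then have "H x < 0" using H[OF True] by simp
        with \<open>\<not> H q0 < 0\<close> show ?thesis by simp
      next
        case False
        then show ?thesis using outside q0(2) by blast
      qed
      have "q0 \<in> interior W"
        using q0(1) frontier_U closure_subset[of W] unfolding Q_def frontier_def by blast
      from no_local_max[OF open_interior this le] show False .
    qed
    have "H q + min 1 (- H q0) \<le> mdiff A H q (\<Lambda> q)" for q
    proof (cases "q \<in> U")
      case True
      then show ?thesis by (simp add: dH H)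
    next
      case False
      then show ?thesis using q0(2)[OF outside[OF False]] mdiff_H_\<Lambda>_nonneg[of q] by linarith
    qed
    with neg show ?thesis by (intro exI[of _ "min 1 (- H q0)"]) simp
  qed
qed

text \<open>Antisymmetry gives \<omega>(u_t, \<Lambda>) = - \<lambda>(u_t), which is the integrand
  of the action with its sign. Integrating the gap inequality over a loop on which \<open>H\<close>
  has mean 0 bounds the denominator below by \<delta>.\<close>

lemma constraint_factor_flow_line_le:
  assumes u: "u \<in> flow_lines A p \<omega> J H xm xp"
    and \<delta>: "\<delta> > 0" "\<And>q. H q + \<delta> \<le> mdiff A H q (\<Lambda> q)"
  shows "\<bar>constraint_factor A \<omega> J H (u s)\<bar> \<le> \<bar>action A (liouville_form \<omega> \<Lambda>) (u s)\<bar> / \<delta>"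
proof -
  have grad: "gradient A (metric_of \<omega> J) H = \<Lambda>" by (rule ext) (rule gradient_eq)
  have act: "d_action A \<omega> (u s) (\<Lambda> \<circ> u s) = action A (liouville_form \<omega> \<Lambda>) (u s)"
    unfolding d_action_def action_def liouville_form_def
    by (subst \<omega>_antisym) simp
  have "continuous_on UNIV (\<lambda>(s, t). u s t)" using flow_lineD(1)[OF u] by (simp add: smooth_plot_on_def)
  then have us: "continuous_on {0..1} (u s)"
    using continuous_on_compose2[of UNIV "\<lambda>(s, t). u s t" "{0..1}" "Pair s"]
    by (simp add: continuous_on_Pair)
  have int: "(\<lambda>t. f (u s t)) integrable_on {0..1}" if "continuous_on UNIV f" for f :: "'a \<Rightarrow> real"
    by (intro integrable_continuous_real continuous_on_compose2[OF that us]) simp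
  have H: "(\<lambda>t. H (u s t)) integrable_on {0..1}" by (rule int[OF continuous_smooth_fun[OF H_smooth]])
  have "\<delta> = integral {0..1} (\<lambda>t. H (u s t) + \<delta>)"
    using flow_lineD(3)[OF u, of s] H by (simp add: integral_add integrable_on_const mean_value_def)
  also have "\<dots> \<le> d_mean_value A H (u s) (\<Lambda> \<circ> u s)"
    unfolding d_mean_value_def o_def
    using H \<delta>(2) by (intro integral_le int[OF continuous_mdiff_H_\<Lambda>] integrable_add) auto
  finally have D: "\<delta> \<le> d_mean_value A H (u s) (\<Lambda> \<circ> u s)" .
  then show ?thesis
    using \<delta>(1) by (simp add: constraint_factor_def grad act abs_divide frac_le)
qed

end

theorem theorem1:
  fixes A :: "('a::{t2_space, second_countable_topology}, 'e::euclidean_space) chart set"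
    and W U :: "'a set"
    and \<omega> :: "'a \<Rightarrow> 'e \<Rightarrow> 'e \<Rightarrow> real"
    and \<Lambda> R :: "'a \<Rightarrow> 'e"
    and \<epsilon> p :: real
    and F :: "real \<Rightarrow> 'a \<Rightarrow> 'a"
    and r H :: "'a \<Rightarrow> real"
    and \<pi> :: "'a \<Rightarrow> 'a"
    and xm xp :: "real \<Rightarrow> 'a"
  assumes completion: "liouville_completion A W \<omega> \<Lambda> \<epsilon> U F r \<pi>"
    and reeb: "reeb_field A (frontier W) \<omega> (liouville_form \<omega> \<Lambda>) U r \<pi> R"
    and defining: "defining_hamiltonian A (frontier W) \<omega> R H"
    and near_boundary: "\<exists>N. open N \<and> frontier W \<subseteq> N \<and> N \<subseteq> U \<and> (\<forall>q\<in>N. H q = exp (r q) - 1)"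
    and p: "p > 1"
    and morse_bott: "morse_bott A p \<omega> (liouville_form \<omega> \<Lambda>) H"
    and critical: "xm \<in> critical_loops A p \<omega> H" "xp \<in> critical_loops A p \<omega> H"
  shows "\<exists>C. \<forall>J. sft_like A \<omega> \<Lambda> U r \<pi> R J \<longrightarrow>
    (\<forall>q v. \<omega> q (gradient A (metric_of \<omega> J) H q) v = liouville_form \<omega> \<Lambda> q v) \<longrightarrow>
    (\<forall>u\<in>flow_lines A p \<omega> J H xm xp. \<forall>s. \<bar>constraint_factor A \<omega> J H (u s)\<bar> \<le> C)"
proof -
  let ?good = "\<lambda>J. sft_like A \<omega> \<Lambda> U r \<pi> R J \<and>
    (\<forall>q v. \<omega> q (gradient A (metric_of \<omega> J) H q) v = liouville_form \<omega> \<Lambda> q v)"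
  have inst: "liouville_gradient A \<omega> \<Lambda> J H" if "?good J" for J
    using that completion defining
    by unfold_locales (auto simp: liouville_completion_def liouville_domain_def Let_def
      defining_hamiltonian_def sft_like_def)
  show ?thesis
  proof (cases "\<exists>J u. ?good J \<and> u \<in> flow_lines A p \<omega> J H xm xp")
    case False
    then show ?thesis by blast
  next
    case True
    then obtain J0 u0 where J0: "?good J0" and u0: "u0 \<in> flow_lines A p \<omega> J0 H xm xp" by blast
    interpret J0: liouville_gradient A \<omega> \<Lambda> J0 H by (rule inst[OF J0])
    obtain \<delta> where \<delta>: "\<delta> > 0" "\<And>q. H q + \<delta> \<le> mdiff A H q (\<Lambda> q)"
      using J0.mdiff_H_\<Lambda>_gap[OF completion reeb] J0 defining
      unfolding sft_like_def defining_hamiltonian_def by blast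
    have x: "continuous_on UNIV xm" "continuous_on UNIV xp"
      using critical by (auto simp: critical_loops_def constraint_set_def w1p_loops_def)
    note C1 = J0.C1_one_form_liouville and flow0 = J0.flow_lineD[OF u0]
    let ?a = "action A (liouville_form \<omega> \<Lambda>)"
    \<comment> \<open>\<open>Bm\<close>, and likewise \<open>Bp\<close>, holds for every plot with
      the given limit, whatever its \<open>J\<close>; \<open>u0\<close> only witnesses that the
      limit is attained in C^1.\<close>
    obtain Bm where Bm: "\<And>u. smooth_plot_on A UNIV (\<lambda>(s, t). u s t) \<Longrightarrow> c1_converges A u xm at_bot \<Longrightarrow>
        \<forall>\<^sub>F s in at_bot. \<bar>?a (u s)\<bar> \<le> Bm"
      using J0.action_bounded_near_limit[OF C1 trivial_limit_at_bot_linorder x(1) flow0(1,4)] by blast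
    obtain Bp where Bp: "\<And>u. smooth_plot_on A UNIV (\<lambda>(s, t). u s t) \<Longrightarrow> c1_converges A u xp at_top \<Longrightarrow>
        \<forall>\<^sub>F s in at_top. \<bar>?a (u s)\<bar> \<le> Bp"
      using J0.action_bounded_near_limit[OF C1 trivial_limit_at_top_linorder x(2) flow0(1,5)] by blast
    have "\<bar>constraint_factor A \<omega> J H (u s)\<bar> \<le> max Bm Bp / \<delta>"
      if J: "?good J" and u: "u \<in> flow_lines A p \<omega> J H xm xp" for J u s
    proof -
      interpret J: liouville_gradient A \<omega> \<Lambda> J H by (rule inst[OF J])
      note flow = J.flow_lineD[OF u]
      \<comment> \<open>The bounds hold near the two ends, hence at some time before
        \<open>s\<close> and at some time after it; monotonicity confines the action at
        \<open>s\<close> between these two values.\<close>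
      obtain s1 where s1: "s1 \<le> s" "\<bar>?a (u s1)\<bar> \<le> Bm"
        using Bm[OF flow(1,4)] unfolding eventually_at_bot_linorder by (meson linorder_linear order_trans)
      obtain s2 where s2: "s \<le> s2" "\<bar>?a (u s2)\<bar> \<le> Bp"
        using Bp[OF flow(1,5)] unfolding eventually_at_top_linorder by (meson linorder_linear order_trans)
      have "?a (u s) \<le> ?a (u s1)" "?a (u s2) \<le> ?a (u s)"
        using J.action_flow_line_antimono[OF u] s1(1) s2(1) by blast+
      then have "\<bar>?a (u s)\<bar> \<le> max Bm Bp" using s1(2) s2(2) by linarith
      then have "\<bar>?a (u s)\<bar> / \<delta> \<le> max Bm Bp / \<delta>" using \<delta>(1) by (intro divide_right_mono) auto
      with J.constraint_factor_flow_line_le[OF u \<delta>, of s] show ?thesis by linarith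
    qed
    then show ?thesis by blast
  qed
qed

end
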